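(* Let $\mathbf M=\{M_k\}_{k\in\mathbb Z}$ be a sequence of Orlicz functions whose conjugate sequence $\mathbf M^*=\{M_k^*\}_{k\in\mathbb Z}$ satisfies $M_k^*(v)>M_k^*(1)=1$ for all $v>1$ and all $k\in\mathbb Z$. Let $\psi\in\Psi$, let $\tau>0$, let $\varphi\in\Phi$ be non-decreasing on $[0,\tau]$, and let $\mu\in\mathcal M(\tau)$. Then for every $n\in\mathbb N$ and $N\in\{2n-1,2n\}$, $$\frac{\mu(\tau)-\mu(0)}{\int_0^\tau\varphi(t)\,d\mu(t)}\,|\psi(n)|\le P_N\Big(L^\psi(\varphi,\tau,\mu,n)^*_{\mathbf M},\mathcal S_{\mathbf M}\Big)\le\frac{\mu(\tau)-\mu(0)}{I_{n,\varphi}(\tau,\mu)}\,|\psi(n)|,$$ where $$I_{n,\varphi}(\tau,\mu):=\inf_{k\in\mathbb N,\ k\ge n}\int_0^{\tau}\varphi\Big(\frac{kt}{n}\Big)\,d\mu(t)$$ and $P_N$ is any of the widths $b_N$, $d_N$, $\lambda_N$ or $\pi_N$ (Bernstein, Kolmogorov, linear, projection). If, in addition, $I_{n,\varphi}(\tau,\mu)=\int_0^\tau\varphi(t)\,d\mu(t)$, then $$P_N\Big(L^\psi(\varphi,\tau,\mu,n)^*_{\mathbf M},\mathcal S_{\mathbf M}\Big)=\frac{\mu(\tau)-\mu(0)}{\int_0^\tau\varphi(t)\,d\mu(t)}\,|\psi(n)|.$$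
   Context: $L$ is the space of $2\pi$-periodic complex-valued Lebesgue summable functions, with Fourier coefficients $\widehat f(k)=(2\pi)^{-1}\int_0^{2\pi}f(x)e^{-ikx}\,dx$, $k\in\mathbb Z$. Spaces and norm. An Orlicz function is a nondecreasing convex function $M(t)$, $t\ge 0$, with $M(0)=0$ and $M(t)\to\infty$ as $t\to\infty$. For a sequence $\mathbf M=\{M_k\}_{k\in\mathbb Z}$ of Orlicz functions, $\mathcal S_{\mathbf M}$ is the space of all $f\in L$ such that $\inf\{a>0:\sum_{k\in\mathbb Z}M_k(|\widehat f(k)|/a)\le 1\}<\infty$. The conjugate sequence is $M_k^*(v):=\sup\{uv-M_k(u):u\ge 0\}$, $v\ge 0$. $\Lambda$ is the set of sequences $\lambda=\{\lambda_k\}_{k\in\mathbb Z}$ of positive numbers with $\sum_{k\in\mathbb Z}M_k^*(\lambda_k)\le 1$. The Orlicz norm of a complex sequence $\{c_k\}_{k\in\mathbb Z}$ is $\sup\{\sum_{k\in\mathbb Z}\lambda_k|c_k|:\lambda\in\Lambda\}$, and $\|f\|^*_{\mathbf M}$ denotes the Orlicz norm of $\{\widehat f(k)\}_{k\in\mathbb Z}$, $f\in\mathcal S_{\mathbf M}$. Generalized modulus of smoothness. $\Phi$ is the set of all continuous bounded nonnegative even functions $\varphi$ on $\mathbb R$ with $\varphi(0)=0$ such that $\{t\in\mathbb R:\varphi(t)=0\}$ has Lebesgue measure zero. For $\varphi\in\Phi$, $h\in\mathbb R$, $f\in\mathcal S_{\mathbf M}$, $\|\Delta_h^\varphi f\|^*_{\mathbf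 M}$ denotes the Orlicz norm of the sequence $\{\varphi(kh)\widehat f(k)\}_{k\in\mathbb Z}$, and $\omega_\varphi(f,t)^*_{\mathbf M}:=\sup_{|h|\le t}\|\Delta_h^\varphi f\|^*_{\mathbf M}$. For $\tau>0$, $\mathcal M(\tau)$ is the set of all bounded non-decreasing non-constant functions $\mu$ on $[0,\tau]$. For $\mu\in\mathcal M(\tau)$ and $u>0$, $$\Omega_\varphi(f,\tau,\mu,u)^*_{\mathbf M}:=\frac{1}{\mu(\tau)-\mu(0)}\int_0^u\omega_\varphi(f,t)^*_{\mathbf M}\,d\mu\Big(\frac{\tau t}{u}\Big),$$ the integrals with respect to $\mu$ being Stieltjes integrals. $\psi$-derivatives and classes. Let $\psi=\{\psi(k)\}_{k\in\mathbb Z}$ be an arbitrary sequence of complex numbers. If $g\in L$ and $F\in L$ satisfy $\widehat F(k)=\psi(k)\widehat g(k)$ for all $k\in\mathbb Z$, then $F$ is called the $\psi$-integral of $g$, and $g=:F^\psi$ is called the $\psi$-derivative of $F$. $L^\psi\mathcal S_{\mathbf M}$ is the set of all $\psi$-integrals of functions from $\mathcal S_{\mathbf M}$. $\Psi$ is the set of sequences $\psi$ of complex numbers with $|\psi(k)|=|\psi(-k)|\ge|\psi(k+1)|$ for all $k\in\mathbb N=\{1,2,\dots\}$. For $n\in\mathbb N$, $$L^\psi(\varphi,\tau,\mu,n)^*_{\mathbf M}:=\Big\{f\in L^\psi\mathcal S_{\mathbf M}:\ \Omega_\varphi\Big(f^\psi,\tau,\mu,\frac{\tau}{n}\Big)^*_{\mathbf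 M}\le 1\Big\}.$$ Widths. Let $K\subset\mathcal S_{\mathbf M}$ be convex and centrally symmetric, and let $B^*_{\mathbf M}$ be the unit ball of $\mathcal S_{\mathbf M}$ for $\|\cdot\|^*_{\mathbf M}$. $F_N$ ranges over $N$-dimensional subspaces of $\mathcal S_{\mathbf M}$; $\mathscr L(\mathcal S_{\mathbf M},F_N)$ is the set of linear operators from $\mathcal S_{\mathbf M}$ to $F_N$, and $\mathscr P(\mathcal S_{\mathbf M},F_N)$ its subset of projections onto $F_N$, i.e. operators $A$ with $Af=f$ for $f\in F_N$. Then $$b_N(K,\mathcal S_{\mathbf M})=\sup_{F_{N+1}}\sup\{\varepsilon>0:\varepsilon B^*_{\mathbf M}\cap F_{N+1}\subset K\},\qquad d_N(K,\mathcal S_{\mathbf M})=\inf_{F_N}\sup_{f\in K}\inf_{u\in F_N}\|f-u\|^*_{\mathbf M},$$ $$\lambda_N(K,\mathcal S_{\mathbf M})=\inf_{F_N}\inf_{A\in\mathscr L(\mathcal S_{\mathbf M},F_N)}\sup_{f\in K}\|f-Af\|^*_{\mathbf M},\qquad \pi_N(K,\mathcal S_{\mathbf M})=\inf_{F_N}\inf_{A\in\mathscr P(\mathcal S_{\mathbf M},F_N)}\sup_{f\in K}\|f-Af\|^*_{\mathbf M}.$$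
   Formalization: For N = 2n the lower estimate, and hence the equality, is stated only when ψ(0) ≠ 0, since for ψ(0) = 0 it can fail (e.g. n = 1, ψ(±1) = 1, ψ = 0 elsewhere); the upper estimate and all of the case N = 2n−1 are as stated. *)

theory Defs
  imports "HOL-Analysis.Analysis"
begin

subsection \<open>The space of periodic summable functions\<close>

definition summable_periodic :: "(real \<Rightarrow> complex) \<Rightarrow> bool" where
  "summable_periodic f \<longleftrightarrow>
     (\<forall>x. f (x + 2 * pi) = f x) \<and> set_integrable lebesgue {0..2 * pi} f"

text \<open>Elements of \<open>L\<close> are functions modulo equality almost everywhere. The quotient matters:
  dimensions of subspaces must not be increased by functions vanishing almost everywhere.\<close>

quotient_type lper = "real \<Rightarrow> complex" / partial:
  "\<lambda>f g. summable_periodic f \<and> summable_periodic g \<and> (AE x in lebesgue. f x = g x)"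
proof (rule part_equivpI)
  have "summable_periodic (\<lambda>_. 0)"
    by (simp add: summable_periodic_def set_integrable_def)
  then show "\<exists>f. summable_periodic f \<and> summable_periodic f \<and> (AE x in lebesgue. f x = f x)"
    by auto
  show "symp (\<lambda>f g. summable_periodic f \<and> summable_periodic g \<and> (AE x in lebesgue. f x = g x))"
    by (rule sympI) (auto elim: eventually_mono)
  show "transp (\<lambda>f g. summable_periodic f \<and> summable_periodic g \<and> (AE x in lebesgue. f x = g x))"
    by (rule transpI) (auto elim: eventually_elim2)
qed

lemma summable_periodic_add:
  "summable_periodic f \<Longrightarrow> summable_periodic g \<Longrightarrow> summable_periodic (\<lambda>x. f x + g x)"
  unfolding summable_periodic_def by (auto intro: set_integral_add)

lemma summable_periodic_scale:
  "summable_periodic f \<Longrightarrow> summable_periodic (\<lambda>x. c * f x)"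
  unfolding summable_periodic_def by auto

instantiation lper :: ab_group_add
begin

lift_definition zero_lper :: lper is "\<lambda>_. 0"
  by (simp add: summable_periodic_def set_integrable_def)

lift_definition plus_lper :: "lper \<Rightarrow> lper \<Rightarrow> lper" is "\<lambda>f g x. f x + g x"
  by (auto intro: summable_periodic_add elim: eventually_elim2)

lift_definition uminus_lper :: "lper \<Rightarrow> lper" is "\<lambda>f x. - f x"
  using summable_periodic_scale[of _ "-1"] by (auto elim: eventually_mono)

definition minus_lper :: "lper \<Rightarrow> lper \<Rightarrow> lper" where
  "minus_lper f g = f + - g"

instance
proof
  fix f g h :: lper
  show "f + g + h = f + (g + h)"
    by transfer (auto intro!: summable_periodic_add simp: add.assoc)
  show "f + g = g + f"
    by transfer (auto intro!: summable_periodic_add simp: add.commute)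
  show "0 + f = f" by transfer auto
  show "- f + f = 0"
    by transfer (auto simp: summable_periodic_def set_integrable_def)
  show "f - g = f + - g" by (rule minus_lper_def)
qed

end

lift_definition scale_lper :: "complex \<Rightarrow> lper \<Rightarrow> lper" is "\<lambda>c f x. c * f x"
  by (auto intro: summable_periodic_scale elim: eventually_mono)

interpretation lper: vector_space scale_lper
proof
  fix a b :: complex and f g :: lper
  show "scale_lper a (f + g) = scale_lper a f + scale_lper a g"
    by transfer (auto intro!: summable_periodic_add summable_periodic_scale simp: algebra_simps)
  show "scale_lper (a + b) f = scale_lper a f + scale_lper b f"
    by transfer
      (auto intro!: summable_periodic_add summable_periodic_scale simp: distrib_right)
  show "scale_lper a (scale_lper b f) = scale_lper (a * b) f"
    by transfer (auto intro!: summable_periodic_scale simp: mult.assoc)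
  show "scale_lper 1 f = f" by transfer auto
qed

lift_definition fourier_coeff :: "lper \<Rightarrow> int \<Rightarrow> complex" is
  "\<lambda>f k. 1 / (2 * of_real pi) *
     (LINT x:{0..2 * pi}|lebesgue. f x * exp (- \<i> * of_int k * of_real x))"
proof -
  fix f g :: "real \<Rightarrow> complex"
  assume *: "summable_periodic f \<and> summable_periodic g \<and> (AE x in lebesgue. f x = g x)"
  have meas: "(\<lambda>x. indicator {0..2 * pi} x *\<^sub>R (h x * exp (- \<i> * of_int k * of_real x)))
      \<in> borel_measurable lebesgue"
    if "summable_periodic h" for h :: "real \<Rightarrow> complex" and k :: int
  proof -
    have 1: "(\<lambda>x. indicator {0..2 * pi} x *\<^sub>R h x) \<in> borel_measurable lebesgue"
      using that unfolding summable_periodic_def set_integrable_def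
      by (auto dest: borel_measurable_integrable)
    have "(\<lambda>x::real. exp (- \<i> * of_int k * of_real x)) \<in> borel_measurable borel"
      by (intro borel_measurable_continuous_onI continuous_intros)
    then have 2: "(\<lambda>x::real. exp (- \<i> * of_int k * of_real x)) \<in> borel_measurable lebesgue"
      by (intro measurable_completion) simp
    show ?thesis
      using borel_measurable_times[OF 1 2] by simp
  qed
  show "(\<lambda>k. 1 / (2 * of_real pi) *
          (LINT x:{0..2 * pi}|lebesgue. f x * exp (- \<i> * of_int k * of_real x))) =
        (\<lambda>k. 1 / (2 * of_real pi) *
          (LINT x:{0..2 * pi}|lebesgue. g x * exp (- \<i> * of_int k * of_real x)))"
    unfolding set_lebesgue_integral_def
    by (intro ext arg_cong2[where f = "(*)"] refl integral_cong_AE meas)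
      (use * in \<open>auto elim: eventually_mono\<close>)
qed


subsection \<open>Musielak--Orlicz type spaces\<close>

definition orlicz_function :: "(real \<Rightarrow> real) \<Rightarrow> bool" where
  "orlicz_function M \<longleftrightarrow>
     mono_on {0..} M \<and> convex_on {0..} M \<and> M 0 = 0 \<and> filterlim M at_top at_top"

text \<open>The infimum of the empty set is \<open>top\<close> in \<open>ennreal\<close>.\<close>

definition luxemburg_norm :: "(int \<Rightarrow> real \<Rightarrow> real) \<Rightarrow> (int \<Rightarrow> complex) \<Rightarrow> ennreal" where
  "luxemburg_norm M c =
     Inf {ennreal a | a. a > 0 \<and> (\<Sum>\<^sub>\<infinity>k\<in>UNIV. ennreal (M k (cmod (c k) / a))) \<le> 1}"

definition orlicz_space :: "(int \<Rightarrow> real \<Rightarrow> real) \<Rightarrow> lper set" where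
  "orlicz_space M = {f. luxemburg_norm M (fourier_coeff f) < top}"

text \<open>The truncation of negative values by \<open>ennreal\<close> is harmless, since the term
  for \<open>u = 0\<close> is \<open>- M 0 = 0\<close>.\<close>

definition orlicz_conjugate :: "(real \<Rightarrow> real) \<Rightarrow> real \<Rightarrow> ennreal" where
  "orlicz_conjugate M v = (SUP u\<in>{0..}. ennreal (u * v - M u))"

definition admissible_weights :: "(int \<Rightarrow> real \<Rightarrow> real) \<Rightarrow> (int \<Rightarrow> real) set" where
  "admissible_weights M =
     {l. (\<forall>k. l k > 0) \<and> (\<Sum>\<^sub>\<infinity>k\<in>UNIV. orlicz_conjugate (M k) (l k)) \<le> 1}"

definition orlicz_norm :: "(int \<Rightarrow> real \<Rightarrow> real) \<Rightarrow> (int \<Rightarrow> complex) \<Rightarrow> ennreal" where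
  "orlicz_norm M c = (SUP l\<in>admissible_weights M. \<Sum>\<^sub>\<infinity>k\<in>UNIV. ennreal (l k * cmod (c k)))"

definition fnorm :: "(int \<Rightarrow> real \<Rightarrow> real) \<Rightarrow> lper \<Rightarrow> ennreal" where
  "fnorm M f = orlicz_norm M (fourier_coeff f)"


subsection \<open>Stieltjes integrals and the generalized modulus of smoothness\<close>

text \<open>The Lebesgue--Stieltjes measure on \<open>[a, b]\<close> of a function \<open>G\<close> that is non-decreasing on
  \<open>[a, b]\<close> but need not be one-sided continuous: \<open>G\<close> is extended by the constants \<open>G a\<close> and
  \<open>G b\<close> and replaced by its right limits, because \<open>interval_measure\<close> requires right continuity.
  The mass of a point of \<open>[a, b]\<close> is the full jump of the extended \<open>G\<close> there, the endpoints
  included, and the total mass is \<open>G b - G a\<close>. Whenever the Riemann--Stieltjes integral of a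
  bounded function with respect to \<open>G\<close> exists, it equals the integral below.\<close>

definition stieltjes_measure :: "(real \<Rightarrow> real) \<Rightarrow> real \<Rightarrow> real \<Rightarrow> real measure" where
  "stieltjes_measure G a b = interval_measure (\<lambda>t. INF s\<in>{t<..}. G (max a (min b s)))"

definition stieltjes_integral ::
    "(real \<Rightarrow> ennreal) \<Rightarrow> (real \<Rightarrow> real) \<Rightarrow> real \<Rightarrow> real \<Rightarrow> ennreal" where
  "stieltjes_integral g G a b = (\<integral>\<^sup>+t\<in>{a..b}. g t \<partial>stieltjes_measure G a b)"

definition Phi_set :: "(real \<Rightarrow> real) set" where
  "Phi_set = {\<phi>. continuous_on UNIV \<phi> \<and> bounded (range \<phi>) \<and> (\<forall>t. \<phi> t \<ge> 0) \<and>
     (\<forall>t. \<phi> (- t) = \<phi> t) \<and> \<phi> 0 = 0 \<and> {t. \<phi> t = 0} \<in> null_sets lebesgue}"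

definition weight_functions :: "real \<Rightarrow> (real \<Rightarrow> real) set" where
  "weight_functions \<tau> = {\<mu>. bounded (\<mu> ` {0..\<tau>}) \<and> mono_on {0..\<tau>} \<mu> \<and>
     \<not> \<mu> constant_on {0..\<tau>}}"

definition modulus ::
    "(int \<Rightarrow> real \<Rightarrow> real) \<Rightarrow> (real \<Rightarrow> real) \<Rightarrow> lper \<Rightarrow> real \<Rightarrow> ennreal" where
  "modulus M \<phi> f t =
     (SUP h\<in>{h. \<bar>h\<bar> \<le> t}.
        orlicz_norm M (\<lambda>k. of_real (\<phi> (real_of_int k * h)) * fourier_coeff f k))"

definition averaged_modulus ::
    "(int \<Rightarrow> real \<Rightarrow> real) \<Rightarrow> (real \<Rightarrow> real) \<Rightarrow> lper \<Rightarrow> real \<Rightarrow> (real \<Rightarrow> real) \<Rightarrow> real \<Rightarrow> ennreal" where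
  "averaged_modulus M \<phi> f \<tau> \<mu> u =
     stieltjes_integral (modulus M \<phi> f) (\<lambda>t. \<mu> (\<tau> * t / u)) 0 u / ennreal (\<mu> \<tau> - \<mu> 0)"


subsection \<open>Classes of psi-integrals\<close>

definition is_psi_integral :: "(int \<Rightarrow> complex) \<Rightarrow> lper \<Rightarrow> lper \<Rightarrow> bool" where
  "is_psi_integral \<psi> g F \<longleftrightarrow> (\<forall>k. fourier_coeff F k = \<psi> k * fourier_coeff g k)"

text \<open>The value at \<open>0\<close> is unrestricted. If \<open>\<psi> 0 = 0\<close>, all \<open>\<psi>\<close>-integrals have mean
  value zero, which lowers by one the dimension in which a lower estimate for widths of the
  classes below can hold.\<close>

definition Psi_set :: "(int \<Rightarrow> complex) set" where
  "Psi_set = {\<psi>. \<forall>k\<ge>1. cmod (\<psi> k) = cmod (\<psi> (- k)) \<and> cmod (\<psi> (- k)) \<ge> cmod (\<psi> (k + 1))}"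

text \<open>If \<open>\<psi>\<close> has zeros, then a function may have several \<open>\<psi>\<close>-derivatives; \<open>f\<close> belongs to
  the class if one of them in the space satisfies the bound.\<close>

definition psi_class ::
    "(int \<Rightarrow> real \<Rightarrow> real) \<Rightarrow> (int \<Rightarrow> complex) \<Rightarrow> (real \<Rightarrow> real) \<Rightarrow> real \<Rightarrow> (real \<Rightarrow> real) \<Rightarrow> nat
      \<Rightarrow> lper set" where
  "psi_class M \<psi> \<phi> \<tau> \<mu> n =
     {f. \<exists>g\<in>orlicz_space M. is_psi_integral \<psi> g f \<and> averaged_modulus M \<phi> g \<tau> \<mu> (\<tau> / real n) \<le> 1}"


subsection \<open>Widths\<close>

definition subspaces_of_dim :: "(int \<Rightarrow> real \<Rightarrow> real) \<Rightarrow> nat \<Rightarrow> lper set set" where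
  "subspaces_of_dim M N =
     {F. F \<subseteq> orlicz_space M \<and>
         (\<exists>B. finite B \<and> card B = N \<and> lper.independent B \<and> lper.span B = F)}"

definition unit_ball :: "(int \<Rightarrow> real \<Rightarrow> real) \<Rightarrow> lper set" where
  "unit_ball M = {f \<in> orlicz_space M. fnorm M f \<le> 1}"

definition linear_operators ::
    "(int \<Rightarrow> real \<Rightarrow> real) \<Rightarrow> lper set \<Rightarrow> (lper \<Rightarrow> lper) set" where
  "linear_operators M F =
     {A. (\<forall>f\<in>orlicz_space M. A f \<in> F) \<and>
         (\<forall>f\<in>orlicz_space M. \<forall>g\<in>orlicz_space M. A (f + g) = A f + A g) \<and>
         (\<forall>c. \<forall>f\<in>orlicz_space M. A (scale_lper c f) = scale_lper c (A f))}"

definition projections ::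
    "(int \<Rightarrow> real \<Rightarrow> real) \<Rightarrow> lper set \<Rightarrow> (lper \<Rightarrow> lper) set" where
  "projections M F = {A \<in> linear_operators M F. \<forall>f\<in>F. A f = f}"

definition bernstein_width :: "(int \<Rightarrow> real \<Rightarrow> real) \<Rightarrow> nat \<Rightarrow> lper set \<Rightarrow> ennreal" where
  "bernstein_width M N K =
     (SUP F\<in>subspaces_of_dim M (N + 1).
        Sup {ennreal \<epsilon> | \<epsilon>. \<epsilon> > 0 \<and> scale_lper (of_real \<epsilon>) ` unit_ball M \<inter> F \<subseteq> K})"

definition kolmogorov_width :: "(int \<Rightarrow> real \<Rightarrow> real) \<Rightarrow> nat \<Rightarrow> lper set \<Rightarrow> ennreal" where
  "kolmogorov_width M N K =
     (INF F\<in>subspaces_of_dim M N. SUP f\<in>K. INF u\<in>F. fnorm M (f - u))"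

definition linear_width :: "(int \<Rightarrow> real \<Rightarrow> real) \<Rightarrow> nat \<Rightarrow> lper set \<Rightarrow> ennreal" where
  "linear_width M N K =
     (INF F\<in>subspaces_of_dim M N. INF A\<in>linear_operators M F. SUP f\<in>K. fnorm M (f - A f))"

definition projection_width :: "(int \<Rightarrow> real \<Rightarrow> real) \<Rightarrow> nat \<Rightarrow> lper set \<Rightarrow> ennreal" where
  "projection_width M N K =
     (INF F\<in>subspaces_of_dim M N. INF A\<in>projections M F. SUP f\<in>K. fnorm M (f - A f))"

text \<open>In \<open>ennreal\<close>, \<open>c / 0 = top\<close> for \<open>c > 0\<close>, and \<open>top * 0 = 0\<close>; hence a vanishing infimum
  gives the upper estimate \<open>top\<close>, unless it is multiplied by \<open>\<psi> n = 0\<close>.\<close>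

definition I_inf :: "nat \<Rightarrow> (real \<Rightarrow> real) \<Rightarrow> real \<Rightarrow> (real \<Rightarrow> real) \<Rightarrow> ennreal" where
  "I_inf n \<phi> \<tau> \<mu> =
     (INF k\<in>{n..}. stieltjes_integral (\<lambda>t. ennreal (\<phi> (real k * t / real n))) \<mu> 0 \<tau>)"

end

theory Submission
  imports Defs
begin

text \<open>
  Both estimates rest on two features of the Orlicz norm: it depends only on the absolute values
  of the coefficients, and it is monotone in them. Hence every Fourier truncation
  \<open>partial_sum S\<close> is a projection of norm at most 1 onto the span \<open>trig_space S\<close> of the
  exponentials with frequencies in \<open>S\<close>.

  Upper estimate. Testing the modulus of \<open>g\<close> at \<open>h = t\<close> with a fixed admissible weight, and
  integrating in \<open>t\<close>, gives the Jackson type inequality \<open>jackson_inequality\<close>: the norm of the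
  coefficients of \<open>g\<close> with \<open>\<bar>k\<bar> \<ge> n\<close>, times the infimum \<open>I\<close>, is at most the
  unnormalized averaged modulus. Since \<open>\<bar>\<psi> k\<bar> \<le> \<bar>\<psi> n\<bar>\<close> for these \<open>k\<close>, the residual
  \<open>f - partial_sum S f\<close> has norm at most \<open>(\<mu> \<tau> - \<mu> 0) / I * \<bar>\<psi> n\<bar>\<close> on the class as soon as
  \<open>S\<close> contains all \<open>k\<close> with \<open>\<bar>k\<bar> < n\<close>. This bounds the Kolmogorov, linear and projection
  widths of order \<open>card S\<close> from above. For the Bernstein width, every subspace of dimension
  \<open>card S + 1\<close> contains some \<open>f \<noteq> 0\<close> whose truncation to \<open>S\<close> vanishes, so that \<open>f\<close> is its own
  residual; scaling it to the sphere of radius \<open>\<epsilon>\<close> bounds \<open>\<epsilon>\<close>. Here one must know that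
  a nonzero element of the space has nonzero norm, which is the uniqueness theorem for Fourier
  coefficients of summable functions (\<open>fourier_coeff_unique\<close>).

  Lower estimate. For \<open>\<bar>k\<bar> \<le> n\<close> and \<open>\<bar>h\<bar> \<le> t \<le> \<tau> / n\<close> monotonicity of \<open>\<phi>\<close> gives
  \<open>\<phi> (k h) \<le> \<phi> (n t)\<close>, so a Bernstein type inequality holds for polynomials of degree \<open>n\<close>, and
  if \<open>\<psi> n \<noteq> 0\<close> and all frequencies in \<open>S\<close> satisfy \<open>\<bar>k\<bar> \<le> n\<close>, with \<open>0 \<in> S\<close> only when
  \<open>\<psi> 0 \<noteq> 0\<close>, the class contains the ball of radius \<open>r\<close> of \<open>trig_space S\<close> for every \<open>r \<ge> 0\<close> with
  \<open>r * J \<le> (\<mu> \<tau> - \<mu> 0) * \<bar>\<psi> n\<bar>\<close> (\<open>ball_subset_psi_class\<close>). Such a ball bounds the Bernstein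
  width from below by definition. For the other widths the topological theorem on widths of
  balls can be avoided: composing with the norm one truncation, an approximating subspace of
  dimension less than \<open>card S\<close> may be replaced by a proper subspace of \<open>trig_space S\<close>, and
  Riesz' lemma (\<open>riesz_trig_space\<close>) yields a vector of norm at most 1 whose distance to it is almost 1.
\<close>

section \<open>Uniqueness of Fourier coefficients of summable functions\<close>

text \<open>An inductive closure of the monomials: products are then handled by two
  inductions, without double sums.\<close>

inductive_set trig_polynomials :: "(real \<Rightarrow> complex) set" where
  monomial: "(\<lambda>x. c * cis (of_int k * x)) \<in> trig_polynomials"
| add: "p \<in> trig_polynomials \<Longrightarrow> q \<in> trig_polynomials \<Longrightarrow> (\<lambda>x. p x + q x) \<in> trig_polynomials"

lemma trig_polynomials_mult:
  assumes "p \<in> trig_polynomials" "q \<in> trig_polynomials"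
  shows "(\<lambda>x. p x * q x) \<in> trig_polynomials"
  using assms
proof (induction rule: trig_polynomials.induct)
  case (monomial c k)
  from monomial show ?case
  proof (induction rule: trig_polynomials.induct)
    case (monomial d l)
    have "(\<lambda>x. c * cis (of_int k * x) * (d * cis (of_int l * x)))
        = (\<lambda>x. (c * d) * cis (of_int (k + l) * x))"
      by (rule ext) (simp add: algebra_simps flip: cis_mult)
    then show ?case by (simp only: trig_polynomials.monomial)
  next
    case (add p q)
    then show ?case by (simp only: distrib_left trig_polynomials.add)
  qed
next
  case (add p q)
  then show ?case by (simp only: distrib_right trig_polynomials.add)
qed

text \<open>A real linear form at \<open>cis x\<close> is a combination of \<open>cos x\<close> and \<open>sin x\<close>. This lets
  the Weierstrass theorem for polynomial functions on the unit circle take the place of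
  approximation by trigonometric polynomials.\<close>

lemma polynomial_on_circle_trig:
  fixes p :: "complex \<Rightarrow> real"
  assumes "real_polynomial_function p"
  shows "(\<lambda>x. complex_of_real (p (cis x))) \<in> trig_polynomials"
  using assms
proof (induction rule: real_polynomial_function.induct)
  case (linear f)
  interpret f: bounded_linear f by fact
  have "complex_of_real (f (cis x)) =
      (of_real (f 1) / 2 - \<i> / 2 * of_real (f \<i>)) * cis (of_int 1 * x) +
      (of_real (f 1) / 2 + \<i> / 2 * of_real (f \<i>)) * cis (of_int (-1) * x)" for x
  proof -
    have "cis x = cos x *\<^sub>R 1 + sin x *\<^sub>R \<i>"
      by (simp add: complex_eq_iff)
    then have "f (cis x) = cos x * f 1 + sin x * f \<i>"
      by (simp add: f.add f.scaleR)
    then show ?thesis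
      by (simp add: complex_eq_iff)
  qed
  then show ?case
    by (simp only: trig_polynomials.intros)
next
  case (const c)
  show ?case
    using trig_polynomials.monomial[of "of_real c" 0] by simp
next
  case (add f g)
  then show ?case by (simp add: trig_polynomials.add)
next
  case (mult f g)
  then show ?case by (simp add: trig_polynomials_mult)
qed

lemma trig_polynomials_continuous_bounded:
  assumes "p \<in> trig_polynomials"
  shows "continuous_on UNIV p \<and> (\<exists>B. \<forall>x. cmod (p x) \<le> B)"
  using assms
proof (induction rule: trig_polynomials.induct)
  case (monomial c k)
  have "cmod (c * cis (real_of_int k * x)) \<le> cmod c" for x
    by (simp add: norm_mult)
  then show ?case
    by (auto intro!: continuous_intros)
next
  case (add p q)
  then obtain B C where "\<And>x. cmod (p x) \<le> B" "\<And>x. cmod (q x) \<le> C" by auto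
  then have "cmod (p x + q x) \<le> B + C" for x
    by (meson add_mono norm_triangle_le)
  with add show ?case
    by (auto intro!: continuous_intros)
qed

lemma integrable_mult_bounded_continuous:
  fixes u g :: "real \<Rightarrow> complex"
  assumes u: "integrable lebesgue u" and g: "continuous_on UNIV g" and B: "\<And>x. cmod (g x) \<le> B"
  shows "integrable lebesgue (\<lambda>x. u x * g x)"
proof (rule Bochner_Integration.integrable_bound[where f = "\<lambda>x. of_real B * u x"])
  show "integrable lebesgue (\<lambda>x. of_real B * u x)"
    using u by simp
  have "g \<in> borel_measurable lebesgue"
    by (intro measurable_completion) (use g in \<open>auto intro: borel_measurable_continuous_onI\<close>)
  then show "(\<lambda>x. u x * g x) \<in> borel_measurable lebesgue"
    using u by (intro borel_measurable_times) auto
  have "cmod (g x) \<le> \<bar>B\<bar>" for x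
    using B[of x] by linarith
  then show "AE x in lebesgue. norm (u x * g x) \<le> norm (complex_of_real B * u x)"
    by (intro AE_I2) (simp add: norm_mult mult.commute mult_right_mono)
qed

lemma integrable_mult_trig_polynomial:
  "integrable lebesgue u \<Longrightarrow> p \<in> trig_polynomials \<Longrightarrow> integrable lebesgue (\<lambda>x. u x * p x)"
  using trig_polynomials_continuous_bounded integrable_mult_bounded_continuous by blast

lemma integral_trig_polynomial_eq_0:
  assumes u: "integrable lebesgue u"
    and 0: "\<And>k::int. (LINT x|lebesgue. u x * cis (of_int k * x)) = 0"
    and p: "p \<in> trig_polynomials"
  shows "(LINT x|lebesgue. u x * p x) = 0"
  using p
proof (induction rule: trig_polynomials.induct)
  case (monomial c k)
  have "(\<lambda>x. u x * (c * cis (real_of_int k * x))) = (\<lambda>x. c * (u x * cis (of_int k * x)))"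
    by (simp add: mult_ac)
  then show ?case
    using 0[of k] by simp
next
  case (add p q)
  have "integrable lebesgue (\<lambda>x. u x * p x)" "integrable lebesgue (\<lambda>x. u x * q x)"
    using u add.hyps by (auto intro: integrable_mult_trig_polynomial)
  then show ?case
    using add.IH by (simp add: distrib_left)
qed

text \<open>On the circle \<open>H\<close> is a uniform limit of polynomials, and these are trigonometric
  polynomials of \<open>x\<close>, to which \<open>u\<close> is orthogonal.\<close>

lemma integral_continuous_on_circle_eq_0:
  fixes H :: "complex \<Rightarrow> real"
  assumes u: "integrable lebesgue u"
    and 0: "\<And>k::int. (LINT x|lebesgue. u x * cis (of_int k * x)) = 0"
    and H: "continuous_on UNIV H"
  shows "(LINT x|lebesgue. u x * of_real (H (cis x))) = 0"
proof -
  have contH: "continuous_on UNIV (\<lambda>x. complex_of_real (H (cis x)))"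
    by (intro continuous_on_of_real continuous_on_compose2[OF H] continuous_intros) auto
  have small: "cmod (LINT x|lebesgue. u x * of_real (H (cis x))) \<le> e * (LINT x|lebesgue. cmod (u x))"
    if e: "e > 0" for e
  proof -
    obtain p where p: "real_polynomial_function p"
      and close: "\<And>z. z \<in> sphere 0 1 \<Longrightarrow> \<bar>H z - p z\<bar> < e"
      using Stone_Weierstrass_real_polynomial_function[of "sphere (0::complex) 1" H e] e
        continuous_on_subset[OF H] by auto
    let ?p = "\<lambda>x. complex_of_real (p (cis x))"
    have tp: "?p \<in> trig_polynomials" by (rule polynomial_on_circle_trig[OF p])
    have close': "cmod (of_real (H (cis x)) - ?p x) \<le> e" for x
      using close[of "cis x"] by (simp flip: of_real_diff)
    have int_p: "integrable lebesgue (\<lambda>x. u x * ?p x)"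
      by (rule integrable_mult_trig_polynomial[OF u tp])
    have int_d: "integrable lebesgue (\<lambda>x. u x * (of_real (H (cis x)) - ?p x))"
      by (rule integrable_mult_bounded_continuous[OF u _ close'])
        (intro continuous_on_diff contH, use trig_polynomials_continuous_bounded[OF tp] in blast)
    have "(LINT x|lebesgue. u x * of_real (H (cis x)))
        = (LINT x|lebesgue. u x * (of_real (H (cis x)) - ?p x) + u x * ?p x)"
      by (simp add: algebra_simps)
    also have "\<dots> = (LINT x|lebesgue. u x * (of_real (H (cis x)) - ?p x))"
      using int_p int_d integral_trig_polynomial_eq_0[OF u 0 tp] by simp
    also have "cmod \<dots> \<le> (LINT x|lebesgue. cmod (u x * (of_real (H (cis x)) - ?p x)))"
      by simp
    also have "\<dots> \<le> (LINT x|lebesgue. e * cmod (u x))"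
    proof (rule integral_mono)
      show "integrable lebesgue (\<lambda>x. cmod (u x * (of_real (H (cis x)) - ?p x)))"
        using int_d by (rule integrable_norm)
      show "integrable lebesgue (\<lambda>x. e * cmod (u x))"
        using u by simp
      show "cmod (u x * (of_real (H (cis x)) - ?p x)) \<le> e * cmod (u x)" for x
        using mult_right_mono[OF close'[of x], of "cmod (u x)"] by (simp add: norm_mult mult.commute)
    qed
    finally show ?thesis by simp
  qed
  let ?I = "LINT x|lebesgue. cmod (u x)"
  have "cmod (LINT x|lebesgue. u x * of_real (H (cis x))) \<le> 0 + e" if "e > 0" for e
  proof -
    have I: "?I \<ge> 0" by simp
    then have "cmod (LINT x|lebesgue. u x * of_real (H (cis x))) \<le> e / (?I + 1) * ?I"
      using that by (intro small divide_pos_pos add_nonneg_pos) auto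
    also have "\<dots> \<le> e / (?I + 1) * (?I + 1)"
      using that I by (intro mult_left_mono divide_nonneg_nonneg) auto
    also have "\<dots> = e"
      using add_nonneg_pos[OF I zero_less_one] by simp
    finally show ?thesis by simp
  qed
  then have "cmod (LINT x|lebesgue. u x * of_real (H (cis x))) \<le> 0"
    by (rule field_le_epsilon)
  then show ?thesis by simp
qed

lemma tent_tendsto_indicator:
  fixes A :: "'a::metric_space set"
  assumes "closed A" "A \<noteq> {}"
  shows "(\<lambda>n. max 0 (1 - real n * infdist z A)) \<longlonglongrightarrow> indicator A z"
proof (cases "z \<in> A")
  case True
  then show ?thesis by simp
next
  case False
  then have pos: "infdist z A > 0"
    using assms infdist_pos_not_in_closed by blast
  obtain m :: nat where m: "1 < real m * infdist z A"
    using reals_Archimedean3[OF pos] by blast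
  have "max 0 (1 - real n * infdist z A) = 0" if "n \<ge> m" for n
  proof -
    have "real m * infdist z A \<le> real n * infdist z A"
      using that pos by (intro mult_right_mono) auto
    then show ?thesis using m by simp
  qed
  then show ?thesis
    using False by (intro tendsto_eventually eventually_sequentiallyI[of m]) simp
qed

text \<open>The indicator of the closed set \<open>cis ` K\<close> is a pointwise limit of continuous functions of
  the distance to it. Since \<open>cis\<close> is injective on \<open>(0, 2\<pi>)\<close>, dominated convergence carries the
  orthogonality over to the indicator of \<open>K\<close> itself.\<close>

lemma integral_compact_eq_0:
  assumes u: "integrable lebesgue u"
    and supp: "\<And>x. x \<notin> {0..2 * pi} \<Longrightarrow> u x = 0"
    and 0: "\<And>k::int. (LINT x|lebesgue. u x * cis (of_int k * x)) = 0"
    and K: "compact K" "K \<subseteq> {0<..<2 * pi}"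
  shows "(LINT x|lebesgue. indicator K x *\<^sub>R u x) = 0"
proof (cases "K = {}")
  case False
  define A where "A = cis ` K"
  have A: "closed A" "A \<noteq> {}"
    using K False by (auto simp: A_def intro!: compact_imp_closed compact_continuous_image continuous_intros)
  have mem: "cis x \<in> A \<longleftrightarrow> x \<in> K" if "x \<in> {0..2 * pi}" "x \<noteq> 0" "x \<noteq> 2 * pi" for x
  proof
    assume "cis x \<in> A"
    then obtain y where y: "y \<in> K" "cis x = cis y" by (auto simp: A_def)
    then obtain m :: int where "x = y + 2 * pi * of_int m"
      by (metis cis.code complex.sel sin_cos_eq_iff)
    note m = this
    have "0 < y" "y < 2 * pi" "0 < x" "x < 2 * pi" using y K that by auto
    then have "2 * pi * of_int m < 2 * pi * 1" "2 * pi * (-1) < 2 * pi * of_int m"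
      using m by linarith+
    then have "real_of_int m < 1" "-1 < real_of_int m"
      using mult_less_cancel_left_pos[of "2 * pi" "of_int m" 1]
        mult_less_cancel_left_pos[of "2 * pi" "- 1" "of_int m"] pi_gt_zero by auto
    then have "m = 0" by linarith
    with m y show "x \<in> K" by simp
  qed (auto simp: A_def)
  let ?H = "\<lambda>n z. max 0 (1 - real n * infdist z A)"
  have cont: "continuous_on UNIV (\<lambda>x. complex_of_real (?H n (cis x)))" for n
    by (intro continuous_intros)
  have bd: "cmod (complex_of_real (?H n (cis x))) \<le> 1" for n x
    by (auto simp: infdist_nonneg)
  have m: "(\<lambda>x. u x * of_real (?H n (cis x))) \<in> borel_measurable lebesgue" for n
    using integrable_mult_bounded_continuous[OF u cont bd] by (rule borel_measurable_integrable)
  have m': "(\<lambda>x. u x * of_real (indicator A (cis x))) \<in> borel_measurable lebesgue"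
    by (rule borel_measurable_LIMSEQ_metric[where f = "\<lambda>n x. u x * of_real (?H n (cis x))"])
      (intro m tendsto_intros tent_tendsto_indicator A)+
  have "(\<lambda>n. LINT x|lebesgue. u x * of_real (?H n (cis x)))
      \<longlonglongrightarrow> (LINT x|lebesgue. u x * of_real (indicator A (cis x)))"
  proof (rule integral_dominated_convergence[where w = "\<lambda>x. cmod (u x)"])
    show "integrable lebesgue (\<lambda>x. cmod (u x))" using u by simp
    show "AE x in lebesgue. (\<lambda>n. u x * of_real (?H n (cis x))) \<longlonglongrightarrow> u x * of_real (indicator A (cis x))"
      by (intro AE_I2 tendsto_intros tent_tendsto_indicator A)
    show "AE x in lebesgue. cmod (u x * of_real (?H n (cis x))) \<le> cmod (u x)" for n
      using bd[of n] by (auto simp: norm_mult intro!: mult_left_le)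
  qed (use m m' in auto)
  moreover have "(LINT x|lebesgue. u x * of_real (?H n (cis x))) = 0" for n
    by (intro integral_continuous_on_circle_eq_0[OF u 0] continuous_intros)
  ultimately have "(LINT x|lebesgue. u x * of_real (indicator A (cis x))) = 0"
    by (simp add: LIMSEQ_const_iff)
  moreover have "AE x in lebesgue. u x * of_real (indicator A (cis x)) = indicator K x *\<^sub>R u x"
  proof (rule AE_I')
    show "{0, 2 * pi} \<in> null_sets lebesgue" by (simp add: null_sets_completionI finite_imp_null_set_lborel)
    have "u x * of_real (indicator A (cis x)) = indicator K x *\<^sub>R u x" if "x \<notin> {0, 2 * pi}" for x
      using mem[of x] supp[of x] that by (cases "x \<in> {0..2 * pi}") (auto simp: indicator_def)
    then show "{x \<in> space lebesgue. u x * of_real (indicator A (cis x)) \<noteq> indicator K x *\<^sub>R u x} \<subseteq> {0, 2 * pi}"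
      by blast
  qed
  moreover have "(\<lambda>x. indicator K x *\<^sub>R u x) \<in> borel_measurable lebesgue"
  proof (intro borel_measurable_scaleR borel_measurable_indicator)
    show "K \<in> sets lebesgue"
      using K by (simp add: borel_compact sets_completionI_sets)
    show "u \<in> borel_measurable lebesgue"
      using u by (rule borel_measurable_integrable)
  qed
  ultimately show ?thesis
    using integral_cong_AE[OF m'] by metis
qed simp

text \<open>By inner regularity the set where \<open>v > 0\<close> is, up to a null set, a countable union of compact
  sets; on each of them the integral of a positive function vanishes, so each of them is null.\<close>

lemma null_set_positive_of_compact:
  fixes v :: "real \<Rightarrow> real"
  assumes v: "integrable lebesgue v"
    and K: "\<And>K. compact K \<Longrightarrow> K \<subseteq> U \<Longrightarrow> (LINT x|lebesgue. indicator K x *\<^sub>R v x) = 0"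
    and U: "U \<in> sets lebesgue"
  shows "{x \<in> U. v x > 0} \<in> null_sets lebesgue"
proof -
  have "{x \<in> space lebesgue. v x > 0} \<in> sets lebesgue"
    using v by (intro borel_measurable_less) auto
  then have "{x \<in> space lebesgue. v x > 0} \<inter> U \<in> sets lebesgue"
    using U by blast
  moreover have "{x \<in> space lebesgue. v x > 0} \<inter> U = {x \<in> U. v x > 0}" by auto
  ultimately obtain C T where C: "fsigma C" and T: "T \<in> null_sets lebesgue"
    and CT: "C \<union> T = {x \<in> U. v x > 0}"
    by (metis lebesgue_set_almost_fsigma)
  from C obtain F :: "nat \<Rightarrow> real set" where F: "range F \<subseteq> Collect compact" "C = \<Union>(range F)"
    using fsigma_Union_compact by metis
  have "F i \<in> null_sets lebesgue" for i
  proof -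
    have co: "compact (F i)" and sub: "F i \<subseteq> {x \<in> U. v x > 0}"
      using F CT by auto
    have meas: "F i \<in> sets lebesgue"
      using co by (simp add: borel_compact sets_completionI_sets)
    have "(LINT x|lebesgue. indicator (F i) x *\<^sub>R v x) = 0"
      using K[OF co] sub by auto
    moreover have "integrable lebesgue (\<lambda>x. indicator (F i) x *\<^sub>R v x)"
      by (rule integrable_mult_indicator[OF meas v])
    moreover have "AE x in lebesgue. 0 \<le> indicator (F i) x *\<^sub>R v x"
      using sub by (intro AE_I2) (auto simp: indicator_def less_imp_le)
    ultimately have "AE x in lebesgue. indicator (F i) x *\<^sub>R v x = 0"
      using integral_nonneg_eq_0_iff_AE by blast
    moreover have "indicator (F i) x *\<^sub>R v x = 0 \<longleftrightarrow> x \<notin> F i" for x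
      using sub by (auto simp: indicator_def)
    ultimately have "AE x in lebesgue. x \<notin> F i" by simp
    then show ?thesis
      using meas by (simp add: AE_iff_null_sets)
  qed
  then show ?thesis
    using T unfolding CT[symmetric] F(2) by auto
qed

lemma null_set_nonzero_of_compact:
  fixes u :: "real \<Rightarrow> complex"
  assumes u: "integrable lebesgue u"
    and K: "\<And>K. compact K \<Longrightarrow> K \<subseteq> U \<Longrightarrow> (LINT x|lebesgue. indicator K x *\<^sub>R u x) = 0"
    and U: "U \<in> sets lebesgue"
  shows "{x \<in> U. u x \<noteq> 0} \<in> null_sets lebesgue"
proof -
  have int: "integrable lebesgue (\<lambda>x. indicator K x *\<^sub>R u x)" if "compact K" for K
    using that by (intro integrable_mult_indicator u) (simp add: borel_compact sets_completionI_sets)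
  have "{x \<in> U. L (u x) > 0} \<in> null_sets lebesgue" if L: "bounded_linear L" for L :: "complex \<Rightarrow> real"
  proof (rule null_set_positive_of_compact[OF _ _ U])
    interpret L: bounded_linear L by fact
    show "integrable lebesgue (\<lambda>x. L (u x))"
      by (rule integrable_bounded_linear[OF L u])
    fix K :: "real set" assume "compact K" "K \<subseteq> U"
    then show "(LINT x|lebesgue. indicator K x *\<^sub>R L (u x)) = 0"
      using integral_bounded_linear[OF L int, of K] K by (simp add: L.scaleR)
  qed
  from this[OF bounded_linear_Re] this[OF bounded_linear_Im]
    this[OF bounded_linear_minus[OF bounded_linear_Re]] this[OF bounded_linear_minus[OF bounded_linear_Im]]
  have "{x \<in> U. Re (u x) > 0} \<union> {x \<in> U. Im (u x) > 0} \<union>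
      {x \<in> U. - Re (u x) > 0} \<union> {x \<in> U. - Im (u x) > 0} \<in> null_sets lebesgue"
    by (intro null_sets.Un)
  also have "{x \<in> U. Re (u x) > 0} \<union> {x \<in> U. Im (u x) > 0} \<union>
      {x \<in> U. - Re (u x) > 0} \<union> {x \<in> U. - Im (u x) > 0} = {x \<in> U. u x \<noteq> 0}"
    by (auto simp: complex_eq_iff)
  finally show ?thesis .
qed

lemma AE_zero_periodic:
  fixes f :: "real \<Rightarrow> complex"
  assumes per: "\<And>x. f (x + p) = f x" and p: "p > 0"
    and null: "{x \<in> {0<..<p}. f x \<noteq> 0} \<in> null_sets lebesgue"
  shows "AE x in lebesgue. f x = 0"
proof -
  \<comment> \<open>The point \<open>0\<close> is added so that the translates of \<open>?N\<close> by multiples of \<open>p\<close> also cover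
    the multiples of \<open>p\<close>.\<close>
  let ?N = "{x \<in> {0<..<p}. f x \<noteq> 0} \<union> {0}"
  have per': "f (x + of_int k * p) = f x" for x and k :: int
  proof (induction k arbitrary: x rule: int_induct[where k = 0])
    case (step1 i)
    have "x + of_int (i + 1) * p = (x + of_int i * p) + p" by (simp add: algebra_simps)
    then show ?case using per step1.IH by metis
  next
    case (step2 i)
    have "(x + of_int (i - 1) * p) + p = x + of_int i * p" by (simp add: algebra_simps)
    then show ?case using per step2.IH by metis
  qed simp
  have "?N \<in> null_sets lebesgue"
    using null by (intro null_sets.Un) (simp_all add: null_sets_completionI finite_imp_null_set_lborel)
  then have "(+) (of_int k * p) ` ?N \<in> null_sets lebesgue" for k :: int
    by (metis negligible_iff_null_sets negligible_translation)
  then have "(\<Union>k::int. (+) (of_int k * p) ` ?N) \<in> null_sets lebesgue"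
    by (rule null_sets_UN)
  moreover have "{x \<in> space lebesgue. \<not> f x = 0} \<subseteq> (\<Union>k::int. (+) (of_int k * p) ` ?N)"
  proof
    fix x assume x: "x \<in> {x \<in> space lebesgue. \<not> f x = 0}"
    define k where "k = \<lfloor>x / p\<rfloor>"
    define y where "y = x - of_int k * p"
    have "of_int k \<le> x / p" "x / p < of_int k + 1"
      unfolding k_def by linarith+
    then have y: "0 \<le> y" "y < p"
      using p by (simp_all add: y_def field_simps)
    have "f y = f x"
      using per'[of y k] by (simp add: y_def)
    then have "y \<in> ?N"
      using x y by (cases "y = 0") auto
    moreover have "x = of_int k * p + y" by (simp add: y_def)
    ultimately show "x \<in> (\<Union>k::int. (+) (of_int k * p) ` ?N)" by blast
  qed
  ultimately show ?thesis
    by (rule AE_I')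
qed

text \<open>Vanishing coefficients make the integral over every compact subset of the period vanish,
  and this forces the function to vanish almost everywhere.\<close>

theorem fourier_coeff_unique:
  assumes "\<And>k. fourier_coeff f k = 0"
  shows "f = 0"
  using assms
proof transfer
  fix f :: "real \<Rightarrow> complex"
  assume f: "summable_periodic f \<and> summable_periodic f \<and> (AE x in lebesgue. f x = f x)"
    and 0: "\<And>k. 1 / (2 * complex_of_real pi) *
         (LINT x:{0..2 * pi}|lebesgue. f x * exp (- \<i> * of_int k * complex_of_real x)) = 0"
  define u where "u = (\<lambda>x. indicator {0..2 * pi} x *\<^sub>R f x)"
  have u: "integrable lebesgue u"
    using f by (simp add: summable_periodic_def set_integrable_def u_def)
  have u0: "(LINT x|lebesgue. u x * cis (of_int k * x)) = 0" for k
    using 0[of "- k"] by (simp add: set_lebesgue_integral_def u_def cis_conv_exp mult_ac)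
  have "{x \<in> {0<..<2 * pi}. u x \<noteq> 0} \<in> null_sets lebesgue"
    by (rule null_set_nonzero_of_compact[OF u integral_compact_eq_0[OF u _ u0]]) (auto simp: u_def)
  also have "{x \<in> {0<..<2 * pi}. u x \<noteq> 0} = {x \<in> {0<..<2 * pi}. f x \<noteq> 0}"
    by (auto simp: u_def)
  finally have "AE x in lebesgue. f x = 0"
    using f by (intro AE_zero_periodic[of f "2 * pi"]) (auto simp: summable_periodic_def)
  then show "summable_periodic f \<and> summable_periodic (\<lambda>_. 0) \<and> (AE x in lebesgue. f x = 0)"
    using f by (simp add: summable_periodic_def set_integrable_def)
qed

section \<open>Trigonometric polynomials and Fourier sums\<close>

lemma set_integrable_mult_exp:
  assumes "summable_periodic f"
  shows "set_integrable lebesgue {0..2 * pi} (\<lambda>x. f x * exp (- \<i> * of_int k * complex_of_real x))"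
proof -
  have "integrable lebesgue (\<lambda>x. indicator {0..2 * pi} x *\<^sub>R f x)"
    using assms by (simp add: summable_periodic_def set_integrable_def)
  then have "integrable lebesgue
      (\<lambda>x. (indicator {0..2 * pi} x *\<^sub>R f x) * exp (- \<i> * of_int k * complex_of_real x))"
    by (rule integrable_mult_bounded_continuous[where B = 1]) (auto intro!: continuous_intros)
  then show ?thesis
    by (simp add: set_integrable_def)
qed

lemma fourier_coeff_add: "fourier_coeff (f + g) k = fourier_coeff f k + fourier_coeff g k"
proof transfer
  fix f g :: "real \<Rightarrow> complex" and k :: int
  assume f: "summable_periodic f \<and> summable_periodic f \<and> (AE x in lebesgue. f x = f x)"
    and g: "summable_periodic g \<and> summable_periodic g \<and> (AE x in lebesgue. g x = g x)"
  show "1 / (2 * complex_of_real pi) *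
      (LINT x:{0..2 * pi}|lebesgue. (f x + g x) * exp (- \<i> * of_int k * of_real x)) =
    1 / (2 * complex_of_real pi) *
      (LINT x:{0..2 * pi}|lebesgue. f x * exp (- \<i> * of_int k * of_real x)) +
    1 / (2 * complex_of_real pi) *
      (LINT x:{0..2 * pi}|lebesgue. g x * exp (- \<i> * of_int k * of_real x))"
    using set_integral_add(2)[OF set_integrable_mult_exp[of f k] set_integrable_mult_exp[of g k]] f g
    by (simp only: distrib_right distrib_left)
qed

lemma fourier_coeff_scale: "fourier_coeff (scale_lper c f) k = c * fourier_coeff f k"
  by transfer (simp add: mult.assoc)

lemma fourier_coeff_zero: "fourier_coeff 0 k = 0"
  using fourier_coeff_scale[of 0 0 k] by simp

lemma fourier_coeff_diff: "fourier_coeff (f - g) k = fourier_coeff f k - fourier_coeff g k"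
  using fourier_coeff_add[of "f - g" g k] by (simp add: algebra_simps)

lemma fourier_coeff_sum: "fourier_coeff (sum f A) k = (\<Sum>x\<in>A. fourier_coeff (f x) k)"
  by (induction A rule: infinite_finite_induct) (simp_all add: fourier_coeff_zero fourier_coeff_add)

lemma lper_eqI: "(\<And>k. fourier_coeff f k = fourier_coeff g k) \<Longrightarrow> f = g"
  using fourier_coeff_unique[of "f - g"] by (simp add: fourier_coeff_diff)

lemma integral_cis:
  "((\<lambda>x. cis (of_int m * x)) has_integral (if m = 0 then 2 * of_real pi else 0)) {0..2 * pi}"
proof (cases "m = 0")
  case True
  then show ?thesis
    using has_integral_const_real[of "1::complex" 0 "2 * pi"] by (simp add: scaleR_conv_of_real)
next
  case False
  define F where "F x = cis (of_int m * x) / (\<i> * of_int m)" for x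
  have "(F has_vector_derivative cis (of_int m * x)) (at x within {0..2 * pi})" for x
  proof -
    have "((\<lambda>z. exp (\<i> * of_int m * z) / (\<i> * of_int m)) has_field_derivative
        exp (\<i> * of_int m * of_real x)) (at (of_real x))"
      using False by (auto intro!: derivative_eq_intros)
    then have "((\<lambda>x. exp (\<i> * of_int m * of_real x) / (\<i> * of_int m)) has_vector_derivative
        exp (\<i> * of_int m * of_real x)) (at x within {0..2 * pi})"
      by (rule has_vector_derivative_real_field)
    then show ?thesis
      by (simp add: F_def[abs_def] cis_conv_exp o_def mult_ac)
  qed
  then have "((\<lambda>x. cis (of_int m * x)) has_integral F (2 * pi) - F 0) {0..2 * pi}"
    by (intro fundamental_theorem_of_calculus) auto
  moreover have "cis (of_int m * (2 * pi)) = 1"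
    using cis_multiple_2pi[of "of_int m"] by (simp add: mult.commute)
  ultimately show ?thesis
    using False by (simp add: F_def)
qed

lift_definition exponential :: "int \<Rightarrow> lper" is "\<lambda>k x. cis (of_int k * x)"
proof -
  fix k :: int
  have "cis (of_int k * (x + 2 * pi)) = cis (of_int k * x)" for x
    using cis_multiple_2pi[of "of_int k"]
    by (simp add: distrib_left mult_ac flip: cis_mult)
  moreover have "set_integrable lebesgue {0..2 * pi} (\<lambda>x. cis (of_int k * x))"
    by (intro absolutely_integrable_continuous_real continuous_intros)
  ultimately show "summable_periodic (\<lambda>x. cis (of_int k * x)) \<and>
      summable_periodic (\<lambda>x. cis (of_int k * x)) \<and>
      (AE x in lebesgue. cis (of_int k * x) = cis (of_int k * x))"
    by (simp add: summable_periodic_def)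
qed

lemma fourier_coeff_exponential: "fourier_coeff (exponential j) k = (if j = k then 1 else 0)"
proof transfer
  fix j k :: int
  have eq: "cis (of_int j * x) * exp (- \<i> * of_int k * of_real x) = cis (of_int (j - k) * x)" for x
    by (simp add: cis_conv_exp algebra_simps flip: exp_add)
  have "set_integrable lebesgue {0..2 * pi} (\<lambda>x. cis (of_int (j - k) * x))"
    by (intro absolutely_integrable_continuous_real continuous_intros)
  then have "(LINT x:{0..2 * pi}|lebesgue. cis (of_int (j - k) * x)) =
      integral {0..2 * pi} (\<lambda>x. cis (of_int (j - k) * x))"
    by (rule set_lebesgue_integral_eq_integral)
  also have "\<dots> = (if j - k = 0 then 2 * of_real pi else 0)"
    by (intro integral_unique integral_cis)
  finally show "1 / (2 * complex_of_real pi) *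
      (LINT x:{0..2 * pi}|lebesgue. cis (of_int j * x) * exp (- \<i> * of_int k * of_real x)) =
      (if j = k then 1 else 0)"
    unfolding eq by simp
qed

definition trig_space :: "int set \<Rightarrow> lper set" where
  "trig_space S = lper.span (exponential ` S)"

definition trig_poly :: "int set \<Rightarrow> (int \<Rightarrow> complex) \<Rightarrow> lper" where
  "trig_poly S c = (\<Sum>k\<in>S. scale_lper (c k) (exponential k))"

definition partial_sum :: "int set \<Rightarrow> lper \<Rightarrow> lper" where
  "partial_sum S f = trig_poly S (fourier_coeff f)"

lemma fourier_coeff_trig_poly:
  "finite S \<Longrightarrow> fourier_coeff (trig_poly S c) k = (if k \<in> S then c k else 0)"
  by (simp add: trig_poly_def fourier_coeff_sum fourier_coeff_scale fourier_coeff_exponential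
      if_distrib sum.delta' cong: if_cong)

lemma fourier_coeff_partial_sum:
  "finite S \<Longrightarrow> fourier_coeff (partial_sum S f) k = (if k \<in> S then fourier_coeff f k else 0)"
  by (simp add: partial_sum_def fourier_coeff_trig_poly)

lemma partial_sum_in_trig_space: "partial_sum S f \<in> trig_space S"
  unfolding partial_sum_def trig_poly_def trig_space_def
  by (intro lper.span_sum lper.span_scale lper.span_base) auto

lemma fourier_coeff_trig_space:
  assumes "f \<in> trig_space S" "k \<notin> S"
  shows "fourier_coeff f k = 0"
  using assms unfolding trig_space_def
  by (induction rule: lper.span_induct_alt)
    (auto simp: fourier_coeff_zero fourier_coeff_add fourier_coeff_scale fourier_coeff_exponential
      split: if_splits)

lemma trig_space_iff:
  assumes "finite S"
  shows "f \<in> trig_space S \<longleftrightarrow> (\<forall>k. k \<notin> S \<longrightarrow> fourier_coeff f k = 0)"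
proof
  assume f: "\<forall>k. k \<notin> S \<longrightarrow> fourier_coeff f k = 0"
  have "partial_sum S f = f"
    by (rule lper_eqI) (use f assms in \<open>auto simp: fourier_coeff_partial_sum\<close>)
  then show "f \<in> trig_space S"
    using partial_sum_in_trig_space by metis
qed (use fourier_coeff_trig_space in blast)

lemma partial_sum_trig_space:
  assumes "finite S" "f \<in> trig_space S"
  shows "partial_sum S f = f"
  by (rule lper_eqI) (use assms in \<open>auto simp: fourier_coeff_partial_sum trig_space_iff\<close>)

lemma inj_exponential: "inj exponential"
  by (rule injI) (metis fourier_coeff_exponential zero_neq_one)

lemma independent_exponential:
  assumes "finite S"
  shows "lper.independent (exponential ` S)"
proof (rule lper.independent_if_scalars_zero)
  fix c x assume sum: "(\<Sum>x\<in>exponential ` S. scale_lper (c x) x) = 0" and x: "x \<in> exponential ` S"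
  from x obtain k where k: "k \<in> S" "x = exponential k" by auto
  have "0 = fourier_coeff (\<Sum>x\<in>exponential ` S. scale_lper (c x) x) k"
    by (simp add: sum fourier_coeff_zero)
  also have "\<dots> = (\<Sum>j\<in>S. c (exponential j) * (if j = k then 1 else 0))"
    by (simp add: sum.reindex inj_on_subset[OF inj_exponential] fourier_coeff_sum fourier_coeff_scale
        fourier_coeff_exponential)
  also have "\<dots> = c x"
    using k assms by (simp add: if_distrib sum.delta' cong: if_cong)
  finally show "c x = 0" by simp
qed (use assms in simp)

text \<open>Fewer homogeneous linear equations than unknowns. The functionals are assembled into one
  linear map into the span of as many exponentials; were it injective, it would carry an
  independent set into the span of a smaller one.\<close>

lemma ex_common_zero:
  fixes L :: "'a \<Rightarrow> lper \<Rightarrow> complex"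
  assumes B: "finite B" "lper.independent B" and J: "finite J" "card J < card B"
    and add: "\<And>j f g. L j (f + g) = L j f + L j g"
    and scale: "\<And>j c f. L j (scale_lper c f) = c * L j f"
  shows "\<exists>f\<in>lper.span B. f \<noteq> 0 \<and> (\<forall>j\<in>J. L j f = 0)"
proof (rule ccontr)
  assume no: "\<not> ?thesis"
  obtain i :: "'a \<Rightarrow> nat" where i: "inj_on i J"
    using J(1) finite_imp_inj_to_nat_seg by blast
  define e where "e j = exponential (int (i j))" for j
  define T where "T f = (\<Sum>j\<in>J. scale_lper (L j f) (e j))" for f
  interpret T: Vector_Spaces.linear scale_lper scale_lper T
    by unfold_locales
      (simp_all add: T_def add scale lper.scale_left_distrib sum.distrib lper.scale_sum_right)
  have coeff: "fourier_coeff (T f) (int (i j)) = L j f" if j: "j \<in> J" for f j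
  proof -
    have "fourier_coeff (T f) (int (i j)) = (\<Sum>l\<in>J. L l f * (if l = j then 1 else 0))"
      unfolding T_def fourier_coeff_sum fourier_coeff_scale e_def fourier_coeff_exponential
      using i j by (intro sum.cong) (auto simp: inj_on_def)
    then show ?thesis
      using J j by (simp add: if_distrib sum.delta' cong: if_cong)
  qed
  have inj: "inj_on T (lper.span B)"
  proof (rule inj_onI)
    fix f g assume "f \<in> lper.span B" "g \<in> lper.span B" and eq: "T f = T g"
    then have "f - g \<in> lper.span B" by (intro lper.span_diff)
    moreover have "L j (f - g) = 0" if "j \<in> J" for j
      using coeff[OF that, of "f - g"] eq by (simp add: T.diff fourier_coeff_zero)
    ultimately have "f - g = 0" using no by blast
    then show "f = g" by simp
  qed
  have "lper.independent (T ` B)"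
    by (rule T.independent_injective_image[OF B(2) inj])
  moreover have "T ` B \<subseteq> lper.span (e ` J)"
    unfolding T_def by (intro image_subsetI lper.span_sum lper.span_scale lper.span_base imageI)
  ultimately have "card (T ` B) \<le> card (e ` J)"
    using lper.independent_span_bound[of "e ` J" "T ` B"] J by auto
  moreover have "card (T ` B) = card B"
    using inj_on_subset[OF inj lper.span_superset] by (rule card_image)
  moreover have "card (e ` J) \<le> card J"
    using J by (intro card_image_le)
  ultimately show False using J by linarith
qed

section \<open>The Orlicz norm of a sequence\<close>

lemma infsum_ennreal_le_iff:
  fixes f :: "'a \<Rightarrow> ennreal"
  shows "infsum f A \<le> b \<longleftrightarrow> (\<forall>F. finite F \<longrightarrow> F \<subseteq> A \<longrightarrow> sum f F \<le> b)"
  by (subst nonneg_infsum_complete) (auto simp: SUP_le_iff)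

lemma sum_le_infsum_ennreal:
  fixes f :: "'a \<Rightarrow> ennreal"
  assumes "finite F" "F \<subseteq> A"
  shows "sum f F \<le> infsum f A"
  using assms infsum_ennreal_le_iff[of f A "infsum f A"] by blast

lemma infsum_mono_ennreal:
  fixes f g :: "'a \<Rightarrow> ennreal"
  assumes "\<And>x. x \<in> A \<Longrightarrow> f x \<le> g x"
  shows "infsum f A \<le> infsum g A"
  by (rule infsum_mono) (auto simp: assms intro: nonneg_summable_on_complete)

lemma infsum_cmult_ennreal:
  fixes f :: "'a \<Rightarrow> ennreal"
  shows "infsum (\<lambda>x. c * f x) A = c * infsum f A"
  by (simp add: nonneg_infsum_complete SUP_mult_left_ennreal sum_distrib_left)

lemma orlicz_norm_le_iff:
  "orlicz_norm M c \<le> b \<longleftrightarrow>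
     (\<forall>l\<in>admissible_weights M. \<forall>F. finite F \<longrightarrow> (\<Sum>k\<in>F. ennreal (l k * cmod (c k))) \<le> b)"
  by (simp add: orlicz_norm_def SUP_le_iff infsum_ennreal_le_iff)

lemma sum_le_orlicz_norm:
  assumes "l \<in> admissible_weights M" "finite F"
  shows "(\<Sum>k\<in>F. ennreal (l k * cmod (c k))) \<le> orlicz_norm M c"
  using assms orlicz_norm_le_iff[of M c "orlicz_norm M c"] by blast

lemma admissible_weights_pos: "l \<in> admissible_weights M \<Longrightarrow> l k > 0"
  by (simp add: admissible_weights_def)

lemma orlicz_norm_mono:
  assumes "\<And>k. cmod (c k) \<le> cmod (d k)"
  shows "orlicz_norm M c \<le> orlicz_norm M d"
  unfolding orlicz_norm_def
proof (intro SUP_mono bexI infsum_mono_ennreal ennreal_leI)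
  fix l k assume "l \<in> admissible_weights M"
  then show "l k * cmod (c k) \<le> l k * cmod (d k)"
    using assms admissible_weights_pos by (intro mult_left_mono) (auto intro: less_imp_le)
qed

lemma orlicz_norm_scale:
  "orlicz_norm M (\<lambda>k. z * c k) = ennreal (cmod z) * orlicz_norm M c"
proof -
  have "ennreal (l k * cmod (z * c k)) = ennreal (cmod z) * ennreal (l k * cmod (c k))"
    if "l \<in> admissible_weights M" for l k
    using admissible_weights_pos[OF that, of k]
    by (simp add: norm_mult less_imp_le mult_ac flip: ennreal_mult)
  then show ?thesis
    by (simp add: orlicz_norm_def infsum_cmult_ennreal SUP_mult_left_ennreal cong: SUP_cong)
qed

lemma orlicz_norm_le_scaled:
  assumes "\<And>k. cmod (c k) \<le> r * cmod (d k)" and "r \<ge> 0"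
  shows "orlicz_norm M c \<le> ennreal r * orlicz_norm M d"
proof -
  have "orlicz_norm M c \<le> orlicz_norm M (\<lambda>k. of_real r * d k)"
    using assms by (intro orlicz_norm_mono) (simp add: norm_mult)
  then show ?thesis
    using assms by (simp add: orlicz_norm_scale)
qed

lemma orlicz_function_nonneg: "orlicz_function M \<Longrightarrow> 0 \<le> u \<Longrightarrow> 0 \<le> M u"
  unfolding orlicz_function_def mono_on_def by (metis atLeast_iff order_refl)

lemma orlicz_function_scale:
  assumes M: "orlicz_function M" and "0 \<le> t" "t \<le> 1" "0 \<le> u"
  shows "M (t * u) \<le> t * M u"
proof -
  have "convex_on {0..} M" "M 0 = 0"
    using M by (auto simp: orlicz_function_def)
  then show ?thesis
    using convex_onD[of "{0..}" M t 0 u] assms by simp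
qed

lemma orlicz_function_mono:
  "orlicz_function M \<Longrightarrow> 0 \<le> u \<Longrightarrow> u \<le> v \<Longrightarrow> M u \<le> M v"
  unfolding orlicz_function_def mono_on_def by auto

lemma young_inequality:
  assumes M: "orlicz_function M" and "0 \<le> u"
  shows "ennreal (v * u) \<le> ennreal (M u) + orlicz_conjugate M v"
proof -
  have "ennreal (v * u) \<le> ennreal (M u) + ennreal (u * v - M u)"
  proof (cases "u * v - M u \<ge> 0")
    case True
    then show ?thesis
      using orlicz_function_nonneg[OF assms]
      by (simp add: mult.commute flip: ennreal_plus)
  next
    case False
    then have "v * u \<le> M u" by (simp add: mult.commute)
    then show ?thesis
      by (simp add: add_increasing2 ennreal_leI)
  qed
  also have "ennreal (u * v - M u) \<le> orlicz_conjugate M v"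
    unfolding orlicz_conjugate_def using assms by (intro SUP_upper) simp
  finally show ?thesis by (simp add: add_left_mono)
qed

text \<open>Convexity of the conjugate at \<open>0\<close>: for \<open>v \<le> 1\<close>, \<open>u v - M u \<le> v (u - M u)\<close> because
  \<open>M u \<ge> 0\<close>.\<close>

lemma orlicz_conjugate_le_scale:
  assumes M: "orlicz_function M" and v: "0 \<le> v" "v \<le> 1"
  shows "orlicz_conjugate M v \<le> ennreal v * orlicz_conjugate M 1"
  unfolding orlicz_conjugate_def SUP_mult_left_ennreal
proof (rule SUP_mono, rule bexI)
  fix u :: real assume u: "u \<in> {0..}"
  have "v * M u \<le> M u"
    using v u orlicz_function_nonneg[OF M, of u] by (simp add: mult_left_le_one_le)
  then have "ennreal (u * v - M u) \<le> ennreal (v * (u * 1 - M u))"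
    by (intro ennreal_leI) (simp add: algebra_simps)
  then show "ennreal (u * v - M u) \<le> ennreal v * ennreal (u * 1 - M u)"
    using v by (simp add: ennreal_mult')
qed

text \<open>One admissible weight already makes the norm dominate a positive multiple of each
  coefficient, which gives positivity of the norm and boundedness of the coefficient functionals.\<close>

lemma ex_admissible_weights:
  assumes M: "\<And>k. orlicz_function (M k)" and 1: "\<And>k. orlicz_conjugate (M k) 1 \<le> 1"
  shows "\<exists>l. l \<in> admissible_weights M"
proof
  \<comment> \<open>An enumeration of the integers turns \<open>1/2 + 1/4 + \<dots> = 1\<close> into weights with sum \<open>1\<close>.\<close>
  define l where "l k = (1 / 2 :: real) ^ Suc (int_encode k)" for k
  have l: "0 < l k" "l k \<le> 1" for k
    by (auto simp: l_def power_le_one simp del: power_Suc)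
  have "(\<Sum>\<^sub>\<infinity>k\<in>UNIV. orlicz_conjugate (M k) (l k)) \<le> (\<Sum>\<^sub>\<infinity>k\<in>UNIV. ennreal (l k))"
  proof (rule infsum_mono_ennreal)
    fix k
    have "orlicz_conjugate (M k) (l k) \<le> ennreal (l k) * orlicz_conjugate (M k) 1"
      using l[of k] by (intro orlicz_conjugate_le_scale M) auto
    also have "\<dots> \<le> ennreal (l k) * 1"
      using 1 by (intro mult_left_mono) auto
    finally show "orlicz_conjugate (M k) (l k) \<le> ennreal (l k)" by simp
  qed
  also have "\<dots> \<le> 1"
    unfolding infsum_ennreal_le_iff
  proof (intro allI impI)
    fix F :: "int set" assume F: "finite F"
    have "(\<Sum>k\<in>F. l k) = (\<Sum>n\<in>int_encode ` F. (1 / 2) ^ Suc n)"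
      by (subst sum.reindex) (auto simp: l_def inj_on_def int_encode_eq)
    also have "\<dots> \<le> (\<Sum>n. (1 / 2) ^ Suc n)"
      using F by (intro sum_le_suminf sums_summable[OF power_half_series]) auto
    also have "\<dots> = 1"
      using power_half_series sums_unique by force
    finally show "(\<Sum>k\<in>F. ennreal (l k)) \<le> 1"
      using l by (subst sum_ennreal) (auto simp: less_imp_le ennreal_le_1)
  qed
  finally show "l \<in> admissible_weights M"
    using l by (simp add: admissible_weights_def)
qed

lemma luxemburg_norm_finite_iff:
  "luxemburg_norm M c < top \<longleftrightarrow>
     (\<exists>a>0. (\<Sum>\<^sub>\<infinity>k\<in>UNIV. ennreal (M k (cmod (c k) / a))) \<le> 1)"
  unfolding luxemburg_norm_def by (auto simp: Inf_less_iff)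

lemma luxemburg_norm_finite_dominated:
  assumes M: "\<And>k. orlicz_function (M k)"
    and d: "luxemburg_norm M d < top"
    and le: "\<And>k. cmod (c k) \<le> r * cmod (d k)"
  shows "luxemburg_norm M c < top"
proof -
  obtain a where a: "a > 0" "(\<Sum>\<^sub>\<infinity>k\<in>UNIV. ennreal (M k (cmod (d k) / a))) \<le> 1"
    using d by (auto simp: luxemburg_norm_finite_iff)
  define b where "b = a * (\<bar>r\<bar> + 1)"
  have b: "b > 0" using a by (simp add: b_def)
  have "cmod (c k) / b \<le> cmod (d k) / a" for k
  proof -
    have "cmod (c k) \<le> (\<bar>r\<bar> + 1) * cmod (d k)"
      using le[of k] by (rule order_trans) (intro mult_right_mono, auto)
    then have "cmod (c k) / (\<bar>r\<bar> + 1) \<le> cmod (d k)"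
      by (simp add: pos_divide_le_eq add_nonneg_pos mult.commute)
    then have "cmod (c k) / (\<bar>r\<bar> + 1) / a \<le> cmod (d k) / a"
      using a by (intro divide_right_mono) auto
    then show ?thesis
      by (simp add: b_def mult.commute)
  qed
  then have "(\<Sum>\<^sub>\<infinity>k\<in>UNIV. ennreal (M k (cmod (c k) / b))) \<le> (\<Sum>\<^sub>\<infinity>k\<in>UNIV. ennreal (M k (cmod (d k) / a)))"
    using b by (intro infsum_mono_ennreal ennreal_leI orlicz_function_mono[OF M]) auto
  then show ?thesis
    using a b order_trans by (auto simp: luxemburg_norm_finite_iff)
qed

text \<open>For \<open>a \<ge> 1\<close>, convexity gives \<open>M (u / a) \<le> M u / a\<close>, so a large \<open>a\<close> makes the finite sum
  at most 1.\<close>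

lemma luxemburg_norm_finite_support:
  assumes M: "\<And>k. orlicz_function (M k)" and S: "finite S" "\<And>k. k \<notin> S \<Longrightarrow> c k = 0"
  shows "luxemburg_norm M c < top"
proof -
  define a where "a = (\<Sum>k\<in>S. M k (cmod (c k))) + 1"
  have nn: "0 \<le> M k (cmod (c k))" for k
    by (intro orlicz_function_nonneg[OF M]) simp
  then have a: "a \<ge> 1" by (simp add: a_def sum_nonneg)
  have M0: "M k 0 = 0" for k using M by (simp add: orlicz_function_def)
  have "(\<Sum>k\<in>F. ennreal (M k (cmod (c k) / a))) \<le> 1" if F: "finite F" for F
  proof -
    have nn': "0 \<le> M k (cmod (c k) / a)" for k
      using a by (intro orlicz_function_nonneg[OF M]) simp
    have "(\<Sum>k\<in>F. M k (cmod (c k) / a)) = (\<Sum>k\<in>F \<inter> S. M k (cmod (c k) / a))"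
      using F S by (intro sum.mono_neutral_right) (auto simp: M0)
    also have "\<dots> \<le> (\<Sum>k\<in>S. M k (cmod (c k) / a))"
      using S nn' by (intro sum_mono2) auto
    also have "\<dots> \<le> (\<Sum>k\<in>S. (1 / a) * M k (cmod (c k)))"
      using orlicz_function_scale[OF M, of "1 / a"] a by (intro sum_mono) simp
    also have "\<dots> = (a - 1) / a"
      by (simp add: a_def sum_divide_distrib)
    also have "\<dots> \<le> 1"
      using a by simp
    finally show ?thesis
      using nn' by (subst sum_ennreal) (auto simp: ennreal_le_1)
  qed
  then show ?thesis
    using a unfolding luxemburg_norm_finite_iff infsum_ennreal_le_iff
    by (intro exI[of _ a]) auto
qed

text \<open>Young's inequality applied termwise: if \<open>a\<close> is admitted in the Luxemburg norm, then the
  Orlicz norm is at most \<open>2 a\<close>.\<close>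

lemma orlicz_norm_finite:
  assumes M: "\<And>k. orlicz_function (M k)" and c: "luxemburg_norm M c < top"
  shows "orlicz_norm M c < top"
proof -
  obtain a where a: "a > 0" "(\<Sum>\<^sub>\<infinity>k\<in>UNIV. ennreal (M k (cmod (c k) / a))) \<le> 1"
    using c by (auto simp: luxemburg_norm_finite_iff)
  have "orlicz_norm M (\<lambda>k. of_real (1 / a) * c k) \<le> 2"
    unfolding orlicz_norm_le_iff
  proof (intro ballI allI impI)
    fix l and F :: "int set" assume l: "l \<in> admissible_weights M" and F: "finite F"
    have "(\<Sum>k\<in>F. ennreal (l k * cmod (of_real (1 / a) * c k)))
        \<le> (\<Sum>k\<in>F. ennreal (M k (cmod (c k) / a)) + orlicz_conjugate (M k) (l k))"
    proof (rule sum_mono)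
      fix k
      show "ennreal (l k * cmod (of_real (1 / a) * c k))
          \<le> ennreal (M k (cmod (c k) / a)) + orlicz_conjugate (M k) (l k)"
        using a young_inequality[OF M[of k], of "cmod (c k) / a" "l k"]
        by (simp add: norm_mult norm_divide)
    qed
    also have "\<dots> = (\<Sum>k\<in>F. ennreal (M k (cmod (c k) / a))) + (\<Sum>k\<in>F. orlicz_conjugate (M k) (l k))"
      by (rule sum.distrib)
    also have "\<dots> \<le> 1 + 1"
      using F a l by (intro add_mono order_trans[OF sum_le_infsum_ennreal[of F UNIV]])
        (auto simp: admissible_weights_def)
    finally show "(\<Sum>k\<in>F. ennreal (l k * cmod (of_real (1 / a) * c k))) \<le> 2"
      by simp
  qed
  then have "orlicz_norm M (\<lambda>k. of_real (1 / a) * c k) < top"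
    by (rule order_le_less_trans) simp
  then have "ennreal (1 / a) * orlicz_norm M c < top"
    using a unfolding orlicz_norm_scale by (simp add: norm_divide)
  then show ?thesis
    using a by (auto simp: ennreal_mult_less_top)
qed

section \<open>Change of variable in Stieltjes integrals\<close>

text \<open>The regularity of \<open>\<lambda>t. INF s\<in>{t<..}. H s\<close> that the theory of \<open>interval_measure\<close>
  requires.\<close>

lemma
  fixes H :: "real \<Rightarrow> real"
  assumes H: "mono H"
  defines "F \<equiv> \<lambda>t. INF s\<in>{t<..}. H s"
  shows mono_right_limit: "x \<le> y \<Longrightarrow> F x \<le> F y"
    and continuous_right_limit: "continuous (at_right a) F"
proof -
  have bdd: "bdd_below (H ` {t<..})" for t
    by (rule bdd_belowI[of _ "H t"]) (use H in \<open>auto simp: mono_def\<close>)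
  show mono: "F x \<le> F y" if "x \<le> y" for x y
    unfolding F_def using that by (intro cINF_superset_mono bdd) auto
  have "(F \<longlongrightarrow> F a) (at_right a)"
  proof (rule order_tendstoI)
    fix c assume "c < F a"
    then have "c < F t" if "a < t" for t
      using mono[of a t] that by linarith
    then show "\<forall>\<^sub>F t in at_right a. c < F t"
      by (auto simp: eventually_at_filter)
  next
    fix c assume "F a < c"
    then obtain s where s: "a < s" "H s < c"
      unfolding F_def using cINF_less_iff[OF _ bdd, of a] by auto
    have "F t < c" if "t < s" for t
    proof -
      have "F t \<le> H s"
        unfolding F_def using that by (intro cINF_lower bdd) simp
      then show ?thesis using s by simp
    qed
    then show "\<forall>\<^sub>F t in at_right a. F t < c"
      using s by (auto simp: eventually_at_right)
  qed
  then show "continuous (at_right a) F"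
    by (simp add: continuous_within)
qed

lemma interval_measure_scale:
  fixes F :: "real \<Rightarrow> real"
  assumes mono: "\<And>x y. x \<le> y \<Longrightarrow> F x \<le> F y" and cont: "\<And>a. continuous (at_right a) F"
    and mono': "\<And>x y. x \<le> y \<Longrightarrow> G x \<le> G y" and cont': "\<And>a. continuous (at_right a) G"
    and c: "c > 0" and G: "\<And>t. G t = F (c * t)"
  shows "interval_measure F = distr (interval_measure G) borel (\<lambda>t. c * t)"
proof (rule measure_eqI_generator_eq[where \<Omega> = UNIV and E = "range (\<lambda>(a, b). {a<..b::real})"
      and A = "\<lambda>n. {- real n<..real n}"])
  show "Int_stable (range (\<lambda>(a, b). {a<..b::real}))"
    by (force simp: Int_stable_def Int_greaterThanAtMost)
  show "sets (interval_measure F) = sigma_sets UNIV (range (\<lambda>(a, b). {a<..b::real}))"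
    "sets (distr (interval_measure G) borel ((*) c)) = sigma_sets UNIV (range (\<lambda>(a, b). {a<..b::real}))"
    by (simp_all add: borel_sigma_sets_Ioc)
  show "(\<Union>n. {- real n<..real n}) = UNIV"
  proof -
    have "x \<in> (\<Union>n. {- real n<..real n})" for x :: real
    proof -
      obtain n :: nat where "\<bar>x\<bar> < real n" using reals_Archimedean2 by blast
      then show ?thesis by (intro UN_I[of n]) auto
    qed
    then show ?thesis by blast
  qed
  show "emeasure (interval_measure F) {- real n<..real n} \<noteq> \<infinity>" for n
    by (simp add: emeasure_interval_measure_Ioc_eq[OF mono cont])
  fix X :: "real set" assume "X \<in> range (\<lambda>(a, b). {a<..b})"
  then obtain a b where X: "X = {a<..b}" by auto
  have "(\<lambda>t. c * t) -` {a<..b} = {a / c<..b / c}"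
    using c by (auto simp: field_simps)
  then have "emeasure (distr (interval_measure G) borel (\<lambda>t. c * t)) X =
      emeasure (interval_measure G) {a / c<..b / c}"
    by (simp add: X emeasure_distr)
  also have "\<dots> = emeasure (interval_measure F) X"
    using c by (simp add: X emeasure_interval_measure_Ioc_eq[OF mono cont]
        emeasure_interval_measure_Ioc_eq[OF mono' cont'] G divide_le_cancel)
  finally show "emeasure (interval_measure F) X =
      emeasure (distr (interval_measure G) borel (\<lambda>t. c * t)) X" ..
qed auto

lemma stieltjes_integral_rescale:
  fixes g :: "real \<Rightarrow> ennreal"
  assumes \<mu>: "mono_on {0..\<tau>} \<mu>" and "\<tau> > 0" "u > 0" and g: "g \<in> borel_measurable borel"
  shows "stieltjes_integral g (\<lambda>t. \<mu> (\<tau> * t / u)) 0 u =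
    stieltjes_integral (\<lambda>t. g (u * t / \<tau>)) \<mu> 0 \<tau>"
proof -
  define c where "c = \<tau> / u"
  have c: "c > 0" using assms by (simp add: c_def)
  define H where "H s = \<mu> (max 0 (min \<tau> s))" for s
  define K where "K s = H (c * s)" for s
  define F where "F t = (INF s\<in>{t<..}. H s)" for t
  define G where "G t = (INF s\<in>{t<..}. K s)" for t
  have H: "mono H"
    using \<mu> \<open>\<tau> > 0\<close> by (auto simp: mono_def H_def mono_on_def)
  have K: "mono K"
    using monoD[OF H] c by (auto simp: mono_def K_def)
  have K_eq: "\<mu> (\<tau> * max 0 (min u s) / u) = K s" for s
  proof -
    have "\<tau> * max 0 (min u s) / u = max 0 (min \<tau> (c * s))"
      using assms by (auto simp: c_def max_def min_def field_simps zero_le_mult_iff)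
    then show ?thesis by (simp add: K_def H_def)
  qed
  have "F (c * t) = G t" for t
  proof -
    have "(\<lambda>s. c * s) ` {t<..} = {c * t<..}"
    proof (intro set_eqI iffI)
      fix x assume "x \<in> {c * t<..}"
      then have "x = c * (x / c)" "x / c \<in> {t<..}"
        using c by (auto simp: field_simps)
      then show "x \<in> (\<lambda>s. c * s) ` {t<..}" by blast
    qed (use c in auto)
    then show ?thesis
      unfolding F_def G_def K_def by (metis image_image)
  qed
  then have meas: "interval_measure F = distr (interval_measure G) borel (\<lambda>t. c * t)"
    using c mono_right_limit[OF H] continuous_right_limit[OF H]
      mono_right_limit[OF K] continuous_right_limit[OF K]
    by (intro interval_measure_scale) (auto simp: F_def[abs_def] G_def[abs_def])
  have "stieltjes_integral (\<lambda>t. g (u * t / \<tau>)) \<mu> 0 \<tau>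
      = (\<integral>\<^sup>+t. g (t / c) * indicator {0..\<tau>} t \<partial>interval_measure F)"
    unfolding stieltjes_integral_def stieltjes_measure_def F_def[abs_def] H_def c_def
    by (simp add: mult.commute)
  also have "\<dots> = (\<integral>\<^sup>+t. g (c * t / c) * indicator {0..\<tau>} (c * t) \<partial>interval_measure G)"
    unfolding meas using g by (subst nn_integral_distr) auto
  also have "\<dots> = (\<integral>\<^sup>+t. g t * indicator {0..u} t \<partial>interval_measure G)"
  proof (rule nn_integral_cong)
    fix t
    have "c * t \<in> {0..\<tau>} \<longleftrightarrow> t \<in> {0..u}"
      using assms by (auto simp: c_def field_simps zero_le_mult_iff)
    then show "g (c * t / c) * indicator {0..\<tau>} (c * t) = g t * indicator {0..u} t"
      using c by (simp add: indicator_def)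
  qed
  also have "\<dots> = stieltjes_integral g (\<lambda>t. \<mu> (\<tau> * t / u)) 0 u"
    unfolding stieltjes_integral_def stieltjes_measure_def G_def[abs_def] K_eq ..
  finally show ?thesis ..
qed

section \<open>Widths and balls of trigonometric polynomials\<close>

lemma fnorm_scale: "fnorm M (scale_lper c f) = ennreal (cmod c) * fnorm M f"
proof -
  have "fourier_coeff (scale_lper c f) = (\<lambda>k. c * fourier_coeff f k)"
    by (rule ext) (rule fourier_coeff_scale)
  then show ?thesis
    by (simp add: fnorm_def orlicz_norm_scale)
qed

lemma fnorm_partial_sum_le: "finite S \<Longrightarrow> fnorm M (partial_sum S f) \<le> fnorm M f"
  unfolding fnorm_def by (intro orlicz_norm_mono) (simp add: fourier_coeff_partial_sum)

lemma coeff_le_fnorm: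
  assumes "l \<in> admissible_weights M"
  shows "ennreal (l k * cmod (fourier_coeff f k)) \<le> fnorm M f"
  using sum_le_orlicz_norm[OF assms, of "{k}" "fourier_coeff f"] by (simp add: fnorm_def)

lemma fnorm_pos:
  assumes l: "l \<in> admissible_weights M" and f: "f \<noteq> 0"
  shows "fnorm M f > 0"
proof -
  obtain k where "fourier_coeff f k \<noteq> 0"
    using fourier_coeff_unique f by blast
  then have "0 < ennreal (l k * cmod (fourier_coeff f k))"
    using admissible_weights_pos[OF l, of k] by simp
  also have "\<dots> \<le> fnorm M f" by (rule coeff_le_fnorm[OF l])
  finally show ?thesis .
qed

lemma trig_space_subset_orlicz_space:
  assumes M: "\<And>k. orlicz_function (M k)" and "finite S"
  shows "trig_space S \<subseteq> orlicz_space M"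
  using assms luxemburg_norm_finite_support[of M, OF M] fourier_coeff_trig_space
  unfolding orlicz_space_def by blast

lemma fnorm_finite:
  "(\<And>k. orlicz_function (M k)) \<Longrightarrow> f \<in> orlicz_space M \<Longrightarrow> fnorm M f < top"
  by (simp add: orlicz_space_def fnorm_def orlicz_norm_finite)

lemma orlicz_space_scale:
  assumes M: "\<And>k. orlicz_function (M k)" and f: "f \<in> orlicz_space M"
  shows "scale_lper c f \<in> orlicz_space M"
  using luxemburg_norm_finite_dominated[of M "fourier_coeff f" "fourier_coeff (scale_lper c f)" "cmod c"]
    assms by (simp add: orlicz_space_def fourier_coeff_scale norm_mult)

lemma fnorm_normalize:
  assumes M: "\<And>k. orlicz_function (M k)" and l: "l \<in> admissible_weights M"
    and f: "f \<in> orlicz_space M" "f \<noteq> 0"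
  obtains r where "r > 0" "fnorm M f = ennreal r" "fnorm M (scale_lper (of_real (1 / r)) f) = 1"
proof -
  have "fnorm M f \<noteq> top" "fnorm M f \<noteq> 0"
    using fnorm_finite[of M, OF M f(1)] fnorm_pos[OF l f(2)] by auto
  then obtain r where r: "r \<ge> 0" "fnorm M f = ennreal r" "r \<noteq> 0"
    by (cases "fnorm M f") auto
  then have "fnorm M (scale_lper (of_real (1 / r)) f) = 1"
    by (simp add: fnorm_scale norm_divide flip: ennreal_mult')
  with r that[of r] show ?thesis by simp
qed

lemma trig_space_in_subspaces_of_dim:
  assumes M: "\<And>k. orlicz_function (M k)" and S: "finite S"
  shows "trig_space S \<in> subspaces_of_dim M (card S)"
proof -
  have "card (exponential ` S) = card S"
    by (rule card_image) (rule inj_on_subset[OF inj_exponential], simp)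
  then show ?thesis
    using trig_space_subset_orlicz_space[of M, OF M S] independent_exponential[OF S] S
    unfolding subspaces_of_dim_def trig_space_def
    by (intro CollectI conjI exI[of _ "exponential ` S"]) simp_all
qed

lemma partial_sum_in_projections:
  assumes "finite S"
  shows "partial_sum S \<in> projections M (trig_space S)"
  unfolding projections_def linear_operators_def
proof (intro CollectI conjI ballI allI)
  fix f g c
  show "partial_sum S f \<in> trig_space S" by (rule partial_sum_in_trig_space)
  show "partial_sum S (f + g) = partial_sum S f + partial_sum S g"
    by (rule lper_eqI) (simp add: fourier_coeff_partial_sum[OF assms] fourier_coeff_add)
  show "partial_sum S (scale_lper c f) = scale_lper c (partial_sum S f)"
    by (rule lper_eqI) (simp add: fourier_coeff_partial_sum[OF assms] fourier_coeff_scale)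
  show "f \<in> trig_space S \<Longrightarrow> partial_sum S f = f"
    by (rule partial_sum_trig_space[OF assms])
qed

text \<open>A subspace of dimension \<open>card S + 1\<close> contains a nonzero \<open>f\<close> whose coefficients vanish on
  \<open>S\<close>. Normalized to norm \<open>\<epsilon>\<close> it lies in \<open>K\<close> and equals its own residual, so \<open>\<epsilon> \<le> R\<close>.\<close>

lemma bernstein_width_le:
  assumes M: "\<And>k. orlicz_function (M k)" and l: "l \<in> admissible_weights M"
    and S: "finite S" and R: "\<And>f. f \<in> K \<Longrightarrow> fnorm M (f - partial_sum S f) \<le> R"
  shows "bernstein_width M (card S) K \<le> R"
  unfolding bernstein_width_def
proof (intro SUP_least Sup_least)
  fix F e assume F: "F \<in> subspaces_of_dim M (card S + 1)"
    and "e \<in> {ennreal \<epsilon> | \<epsilon>. \<epsilon> > 0 \<and> scale_lper (of_real \<epsilon>) ` unit_ball M \<inter> F \<subseteq> K}"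
  then obtain \<epsilon> where \<epsilon>: "e = ennreal \<epsilon>" "\<epsilon> > 0"
    and sub: "scale_lper (of_real \<epsilon>) ` unit_ball M \<inter> F \<subseteq> K" by auto
  obtain B where B: "finite B" "card B = card S + 1" "lper.independent B" and FB: "lper.span B = F"
    and Fsub: "F \<subseteq> orlicz_space M"
    using F by (auto simp: subspaces_of_dim_def)
  obtain f where f: "f \<in> F" "f \<noteq> 0" "\<And>k. k \<in> S \<Longrightarrow> fourier_coeff f k = 0"
    using ex_common_zero[of B S "\<lambda>k f. fourier_coeff f k"] B S FB
    by (auto simp: fourier_coeff_add fourier_coeff_scale)
  obtain r where r: "r > 0" "fnorm M (scale_lper (of_real (1 / r)) f) = 1"
    using fnorm_normalize[of M, OF M l] f Fsub by blast
  define g where "g = scale_lper (of_real (1 / r)) f"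
  have g: "fnorm M g = 1" using r by (simp add: g_def)
  moreover have "g \<in> orlicz_space M"
    unfolding g_def using f Fsub by (intro orlicz_space_scale[of M, OF M]) auto
  ultimately have "g \<in> unit_ball M"
    by (simp add: unit_ball_def)
  moreover have "scale_lper (of_real \<epsilon>) g \<in> F"
    using f unfolding g_def FB[symmetric] by (intro lper.span_scale)
  ultimately have "scale_lper (of_real \<epsilon>) g \<in> K"
    using sub by blast
  moreover have "partial_sum S (scale_lper (of_real \<epsilon>) g) = 0"
    by (rule lper_eqI)
      (simp add: fourier_coeff_partial_sum[OF S] fourier_coeff_zero fourier_coeff_scale g_def f)
  ultimately have "fnorm M (scale_lper (of_real \<epsilon>) g) \<le> R"
    using R by force
  then show "e \<le> R"
    using g \<epsilon> by (simp add: fnorm_scale)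
qed

lemma widths_le:
  assumes M: "\<And>k. orlicz_function (M k)" and l: "l \<in> admissible_weights M"
    and S: "finite S" and R: "\<And>f. f \<in> K \<Longrightarrow> fnorm M (f - partial_sum S f) \<le> R"
    and P: "P \<in> {bernstein_width M, kolmogorov_width M, linear_width M, projection_width M}"
  shows "P (card S) K \<le> R"
proof -
  note V = trig_space_in_subspaces_of_dim[of M, OF M S]
  note proj = partial_sum_in_projections[OF S, of M]
  have lin: "partial_sum S \<in> linear_operators M (trig_space S)"
    using proj by (simp add: projections_def)
  have "kolmogorov_width M (card S) K \<le> R"
    unfolding kolmogorov_width_def
    by (rule INF_lower2[OF V], rule SUP_least, rule INF_lower2[OF partial_sum_in_trig_space], rule R)
  moreover have "linear_width M (card S) K \<le> R"
    unfolding linear_width_def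
    by (rule INF_lower2[OF V], rule INF_lower2[OF lin], rule SUP_least, rule R)
  moreover have "projection_width M (card S) K \<le> R"
    unfolding projection_width_def
    by (rule INF_lower2[OF V], rule INF_lower2[OF proj], rule SUP_least, rule R)
  ultimately show ?thesis
    using P bernstein_width_le[of M, OF M l S R] by auto
qed

text \<open>Riesz' lemma with approximants outside \<open>trig_space S\<close>. As \<open>dim V < card S\<close>, some nonzero
  functional \<open>L\<close>, acting only on coefficients in \<open>S\<close>, vanishes on \<open>V\<close>. Truncation to \<open>S\<close> does
  not increase the norm, so the norm \<open>D\<close> of \<open>L\<close> on the whole space is already its norm on
  \<open>trig_space S\<close>; if \<open>y\<close> nearly attains it, then
  \<open>\<theta> D \<le> \<bar>L y\<bar> = \<bar>L (y - u)\<bar> \<le> D \<parallel>y - u\<parallel>\<close> for all \<open>u \<in> V\<close>.\<close>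

lemma riesz_trig_space:
  assumes M: "\<And>k. orlicz_function (M k)" and l: "l \<in> admissible_weights M"
    and S: "finite S" and V: "V \<in> subspaces_of_dim M N" and N: "N < card S"
    and \<theta>: "0 \<le> \<theta>" "\<theta> < 1"
  shows "\<exists>y\<in>trig_space S. fnorm M y \<le> 1 \<and> (\<forall>u\<in>V. ennreal \<theta> \<le> fnorm M (y - u))"
proof -
  obtain B where B: "finite B" "card B = N" "lper.span B = V"
    using V by (auto simp: subspaces_of_dim_def)
  have card: "card (exponential ` S) = card S"
    by (rule card_image) (rule inj_on_subset[OF inj_exponential], simp)
  let ?pair = "\<lambda>u f. \<Sum>k\<in>S. fourier_coeff f k * fourier_coeff u k"
  have "?pair u (f + g) = ?pair u f + ?pair u g" for u f g
    by (simp add: fourier_coeff_add distrib_right sum.distrib)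
  moreover have "?pair u (scale_lper c f) = c * ?pair u f" for u c f
    by (simp add: fourier_coeff_scale sum_distrib_left mult.assoc)
  ultimately have "\<exists>f\<in>lper.span (exponential ` S). f \<noteq> 0 \<and> (\<forall>b\<in>B. ?pair b f = 0)"
    using B S N card independent_exponential[OF S] by (intro ex_common_zero) simp_all
  then obtain a where a: "a \<in> trig_space S" "a \<noteq> 0" and aB: "\<And>b. b \<in> B \<Longrightarrow> ?pair b a = 0"
    unfolding trig_space_def by blast
  define L where "L y = (\<Sum>k\<in>S. fourier_coeff a k * fourier_coeff y k)" for y
  have L_V: "L u = 0" if "u \<in> V" for u
    using that unfolding B(3)[symmetric]
    by (induction rule: lper.span_induct_alt)
      (use aB in \<open>auto simp: L_def fourier_coeff_zero fourier_coeff_add fourier_coeff_scale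
        distrib_left sum.distrib mult.left_commute simp flip: sum_distrib_left\<close>)
  have L_diff: "L (f - g) = L f - L g" for f g
    by (simp add: L_def fourier_coeff_diff right_diff_distrib sum_subtractf)
  have L_scale: "L (scale_lper c f) = c * L f" for c f
    by (simp add: L_def fourier_coeff_scale sum_distrib_left mult_ac)
  have L_partial: "L (partial_sum S z) = L z" for z
    unfolding L_def by (intro sum.cong) (auto simp: fourier_coeff_partial_sum[OF S])
  define D where "D = (SUP y\<in>{y\<in>trig_space S. fnorm M y \<le> 1}. ennreal (cmod (L y)))"
  have L_le: "ennreal (cmod (L z)) \<le> D * fnorm M z" for z
  proof (cases "partial_sum S z = 0")
    case True
    then have "L z = 0"
      using L_partial[of z] L_scale[of 0 0] by simp
    then show ?thesis by simp
  next
    case False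
    let ?w = "partial_sum S z"
    have w: "?w \<in> trig_space S" by (rule partial_sum_in_trig_space)
    obtain r where r: "r > 0" "fnorm M ?w = ennreal r" "fnorm M (scale_lper (of_real (1 / r)) ?w) = 1"
      using fnorm_normalize[of M, OF M l _ False] w trig_space_subset_orlicz_space[of M, OF M S] by blast
    have "scale_lper (of_real (1 / r)) ?w \<in> trig_space S"
      using w unfolding trig_space_def by (rule lper.span_scale)
    then have "ennreal (cmod (L (scale_lper (of_real (1 / r)) ?w))) \<le> D"
      unfolding D_def using r by (intro SUP_upper) simp
    then have "ennreal (cmod (L z) / r) * ennreal r \<le> D * ennreal r"
      using r by (intro mult_right_mono) (simp_all add: L_scale L_partial norm_mult norm_divide)
    then have "ennreal (cmod (L z)) \<le> D * fnorm M ?w"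
      using r by (simp flip: ennreal_mult')
    also have "\<dots> \<le> D * fnorm M z"
      by (intro mult_left_mono fnorm_partial_sum_le S) simp
    finally show ?thesis .
  qed
  obtain k where k: "fourier_coeff a k \<noteq> 0"
    using fourier_coeff_unique a by blast
  then have kS: "k \<in> S" using fourier_coeff_trig_space a by blast
  have "L (exponential k) = fourier_coeff a k"
    using kS S by (simp add: L_def fourier_coeff_exponential if_distrib sum.delta cong: if_cong)
  then have "D \<noteq> 0"
    using L_le[of "exponential k"] k by auto
  moreover have "D \<noteq> top"
  proof -
    have "D \<le> ennreal (\<Sum>k\<in>S. cmod (fourier_coeff a k) * (1 / l k))"
      unfolding D_def
    proof (intro SUP_least ennreal_leI)
      fix y assume y: "y \<in> {y \<in> trig_space S. fnorm M y \<le> 1}"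
      have "cmod (fourier_coeff y k) \<le> 1 / l k" for k
      proof -
        have "ennreal (l k * cmod (fourier_coeff y k)) \<le> 1"
          using order_trans[OF coeff_le_fnorm[OF l, of k y], of 1] y by blast
        then have "l k * cmod (fourier_coeff y k) \<le> 1" by simp
        then show ?thesis
          using admissible_weights_pos[OF l, of k] by (simp add: field_simps)
      qed
      then show "cmod (L y) \<le> (\<Sum>k\<in>S. cmod (fourier_coeff a k) * (1 / l k))"
        unfolding L_def by (intro sum_norm_le) (simp only: norm_mult mult_left_mono norm_ge_zero)
    qed
    then show ?thesis using top.extremum_uniqueI ennreal_less_top by fastforce
  qed
  ultimately obtain d where d: "D = ennreal d" "d > 0"
    by (cases D) auto
  have "ennreal (\<theta> * d) < D"
    using d \<theta> by (simp add: ennreal_less_iff)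
  then obtain y where y: "y \<in> trig_space S" "fnorm M y \<le> 1" "ennreal (\<theta> * d) < ennreal (cmod (L y))"
    unfolding D_def less_SUP_iff by blast
  have "ennreal \<theta> \<le> fnorm M (y - u)" if "u \<in> V" for u
  proof -
    have "ennreal (\<theta> * d) \<le> D * fnorm M (y - u)"
      using y(3) L_le[of "y - u"] L_V[OF that] by (simp add: L_diff)
    then have "ennreal d * ennreal \<theta> \<le> ennreal d * fnorm M (y - u)"
      using d \<theta> by (simp add: mult.commute ennreal_mult)
    then show ?thesis
      using d by (simp add: ennreal_mult_le_mult_iff)
  qed
  with y show ?thesis by blast
qed

text \<open>The Bernstein width sees the ball directly. For the other widths, Riesz' lemma scaled by
  \<open>r\<close> gives points of the ball whose distance to a given \<open>N\<close>-dimensional subspace is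
  arbitrarily close to \<open>r\<close>; the image of an operator into that subspace does no better.\<close>

lemma widths_ge:
  assumes M: "\<And>k. orlicz_function (M k)" and l: "l \<in> admissible_weights M"
    and S: "finite S" "card S = N + 1" and r: "r > 0"
    and K: "\<And>f. f \<in> trig_space S \<Longrightarrow> fnorm M f \<le> ennreal r \<Longrightarrow> f \<in> K"
    and P: "P \<in> {bernstein_width M, kolmogorov_width M, linear_width M, projection_width M}"
  shows "ennreal r \<le> P N K"
proof -
  have far: "\<exists>f\<in>K \<inter> orlicz_space M. \<forall>u\<in>V. x \<le> fnorm M (f - u)"
    if x: "x < ennreal r" and V: "V \<in> subspaces_of_dim M N" for x V
  proof -
    obtain s where s: "x = ennreal s" "0 \<le> s" "s < r"
      using x by (cases x) (auto simp: ennreal_less_iff)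
    then have "0 \<le> s / r" "s / r < 1" using r by auto
    then obtain y where y: "y \<in> trig_space S" "fnorm M y \<le> 1"
      and far: "\<And>u. u \<in> V \<Longrightarrow> ennreal (s / r) \<le> fnorm M (y - u)"
      using riesz_trig_space[of M, OF M l S(1) V] S by fastforce
    let ?f = "scale_lper (of_real r) y"
    have f: "?f \<in> trig_space S"
      using y(1) unfolding trig_space_def by (rule lper.span_scale)
    have "fnorm M ?f \<le> ennreal r * 1"
      unfolding fnorm_scale using r y by (intro mult_mono) auto
    then have "?f \<in> K" using K[OF f] by simp
    moreover have "?f \<in> orlicz_space M"
      using f trig_space_subset_orlicz_space[of M, OF M S(1)] by blast
    moreover have "x \<le> fnorm M (?f - u)" if u: "u \<in> V" for u
    proof -
      have "scale_lper (of_real (1 / r)) u \<in> V"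
        using u V by (auto simp: subspaces_of_dim_def intro: lper.span_scale)
      then have "ennreal r * ennreal (s / r) \<le> ennreal r * fnorm M (y - scale_lper (of_real (1 / r)) u)"
        by (intro mult_left_mono far) auto
      also have "\<dots> = fnorm M (scale_lper (of_real r) (y - scale_lper (of_real (1 / r)) u))"
        using r by (simp add: fnorm_scale)
      also have "scale_lper (of_real r) (y - scale_lper (of_real (1 / r)) u) = ?f - u"
        using r by (simp add: lper.scale_right_diff_distrib)
      finally show ?thesis
        using r s by (simp flip: ennreal_mult')
    qed
    ultimately show ?thesis by blast
  qed
  have "ennreal r \<le> bernstein_width M N K"
    unfolding bernstein_width_def
  proof (rule SUP_upper2)
    show "trig_space S \<in> subspaces_of_dim M (N + 1)"
      using trig_space_in_subspaces_of_dim[of M, OF M S(1)] S by simp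
    have "scale_lper (of_real r) ` unit_ball M \<inter> trig_space S \<subseteq> K"
    proof
      fix f assume f: "f \<in> scale_lper (of_real r) ` unit_ball M \<inter> trig_space S"
      then obtain g where g: "f = scale_lper (of_real r) g" "fnorm M g \<le> 1"
        by (auto simp: unit_ball_def)
      have "fnorm M f \<le> ennreal r * 1"
        unfolding g fnorm_scale using r g by (intro mult_mono) auto
      then show "f \<in> K" using f K by simp
    qed
    then show "ennreal r \<le> Sup {ennreal \<epsilon> | \<epsilon>. \<epsilon> > 0 \<and> scale_lper (of_real \<epsilon>) ` unit_ball M \<inter> trig_space S \<subseteq> K}"
      using r by (intro Sup_upper) blast
  qed
  moreover have "ennreal r \<le> kolmogorov_width M N K"
    unfolding kolmogorov_width_def
  proof (intro INF_greatest, rule dense_le)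
    fix V x assume "V \<in> subspaces_of_dim M N" "x < ennreal r"
    then obtain f where "f \<in> K" "\<And>u. u \<in> V \<Longrightarrow> x \<le> fnorm M (f - u)"
      using far by blast
    then show "x \<le> (SUP f\<in>K. INF u\<in>V. fnorm M (f - u))"
      by (intro SUP_upper2[of f] INF_greatest)
  qed
  moreover have lin: "ennreal r \<le> (SUP f\<in>K. fnorm M (f - A f))"
    if V: "V \<in> subspaces_of_dim M N" and A: "A \<in> linear_operators M V" for V A
  proof (rule dense_le)
    fix x assume "x < ennreal r"
    then obtain f where f: "f \<in> K" "f \<in> orlicz_space M" "\<And>u. u \<in> V \<Longrightarrow> x \<le> fnorm M (f - u)"
      using far V by blast
    then have "A f \<in> V" using A by (simp add: linear_operators_def)
    then show "x \<le> (SUP f\<in>K. fnorm M (f - A f))"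
      using f by (intro SUP_upper2[of f])
  qed
  have "ennreal r \<le> linear_width M N K"
    unfolding linear_width_def by (intro INF_greatest lin)
  moreover have "ennreal r \<le> projection_width M N K"
    unfolding projection_width_def by (intro INF_greatest lin) (auto simp: projections_def)
  ultimately show ?thesis using P by auto
qed

section \<open>Jackson and Bernstein type estimates\<close>

lemma Phi_set_even_abs:
  assumes "\<phi> \<in> Phi_set"
  shows "\<phi> \<bar>t\<bar> = \<phi> t"
proof -
  have "\<phi> (- t) = \<phi> t" using assms unfolding Phi_set_def by blast
  then show ?thesis by (simp add: abs_if)
qed

lemma Phi_set_nonneg: "\<phi> \<in> Phi_set \<Longrightarrow> \<phi> t \<ge> 0"
  unfolding Phi_set_def by blast

lemma Phi_set_measurable:
  assumes "\<phi> \<in> Phi_set"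
  shows "(\<lambda>t. ennreal (\<phi> (c * t))) \<in> borel_measurable borel"
proof -
  have "continuous_on UNIV \<phi>" using assms unfolding Phi_set_def by blast
  then have "continuous_on UNIV (\<lambda>t. \<phi> (c * t))"
    by (rule continuous_on_compose2) (auto intro: continuous_intros)
  then show ?thesis
    by (intro measurable_compose[OF _ measurable_ennreal] borel_measurable_continuous_onI)
qed

lemma Phi_set_measurable_indicator:
  assumes "\<phi> \<in> Phi_set"
  shows "(\<lambda>t. ennreal (\<phi> (c * t)) * indicator {a..b} t) \<in> borel_measurable (stieltjes_measure G a' b')"
proof -
  have "(\<lambda>t. ennreal (\<phi> (c * t)) * indicator {a..b} t) \<in> borel_measurable borel"
    using Phi_set_measurable[OF assms, of c] by (intro borel_measurable_times_ennreal borel_measurable_indicator) auto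
  moreover have "sets (stieltjes_measure G a' b') = sets borel"
    by (simp add: stieltjes_measure_def)
  ultimately show ?thesis by (simp cong: measurable_cong_sets)
qed

lemma Psi_set_antimono:
  assumes \<psi>: "\<psi> \<in> Psi_set" and "1 \<le> \<bar>j\<bar>" "\<bar>j\<bar> \<le> \<bar>k\<bar>"
  shows "cmod (\<psi> k) \<le> cmod (\<psi> j)"
proof -
  have flip: "cmod (\<psi> k) = cmod (\<psi> (- k))" and dec: "cmod (\<psi> (k + 1)) \<le> cmod (\<psi> (- k))"
    if "k \<ge> 1" for k
    using \<psi> that unfolding Psi_set_def by blast+
  have sym: "cmod (\<psi> \<bar>k\<bar>) = cmod (\<psi> k)" if "\<bar>k\<bar> \<ge> 1" for k
    using flip[of "\<bar>k\<bar>"] that by (cases "k \<ge> 0") simp_all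
  have "cmod (\<psi> \<bar>k\<bar>) \<le> cmod (\<psi> \<bar>j\<bar>)"
    using assms(3)
  proof (induction rule: int_ge_induct)
    case (step i)
    then show ?case
      using assms(2) flip[of i] dec[of i] by linarith
  qed simp
  then show ?thesis
    using sym[of k] sym[of j] assms by simp
qed

lemma weight_function_increment_pos:
  assumes "\<mu> \<in> weight_functions \<tau>" "\<tau> > 0"
  shows "\<mu> \<tau> - \<mu> 0 > 0"
proof (rule ccontr)
  assume "\<not> ?thesis"
  moreover have "\<mu> 0 \<le> \<mu> x" "\<mu> x \<le> \<mu> \<tau>" if "x \<in> {0..\<tau>}" for x
    using assms that by (auto simp: weight_functions_def mono_on_def)
  ultimately have "\<mu> x = \<mu> 0" if "x \<in> {0..\<tau>}" for x
    using that by force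
  then have "\<mu> constant_on {0..\<tau>}"
    unfolding constant_on_def by blast
  then show False using assms by (simp add: weight_functions_def)
qed

text \<open>For an admissible \<open>l\<close> the finite sums of \<open>l k * \<phi> (k t) * \<bar>g k\<bar>\<close>, where \<open>g k\<close> stands for a
  Fourier coefficient, are at most the modulus at \<open>t\<close>. After integration each \<open>\<phi> (k t)\<close> with
  \<open>\<bar>k\<bar> \<ge> n\<close> contributes at least \<open>I\<close>, by rescaling to \<open>[0, \<tau>]\<close> and evenness of \<open>\<phi>\<close>.\<close>

lemma jackson_inequality:
  assumes \<phi>: "\<phi> \<in> Phi_set" and \<mu>: "mono_on {0..\<tau>} \<mu>" and \<tau>: "\<tau> > 0" and n: "n \<ge> 1"
  shows "orlicz_norm M (\<lambda>k. if \<bar>k\<bar> \<ge> int n then fourier_coeff g k else 0) * I_inf n \<phi> \<tau> \<mu>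
    \<le> stieltjes_integral (modulus M \<phi> g) (\<lambda>t. \<mu> (\<tau> * t / (\<tau> / real n))) 0 (\<tau> / real n)"
proof -
  let ?u = "\<tau> / real n" and ?I = "I_inf n \<phi> \<tau> \<mu>"
  let ?m = "stieltjes_measure (\<lambda>t. \<mu> (\<tau> * t / ?u)) 0 ?u"
  let ?c = "\<lambda>k. if \<bar>k\<bar> \<ge> int n then fourier_coeff g k else 0"
  have u: "?u > 0" using \<tau> n by simp
  have meas: "(\<lambda>t. ennreal (\<phi> (of_int k * t)) * indicator {0..?u} t) \<in> borel_measurable ?m" for k
    by (rule Phi_set_measurable_indicator[OF \<phi>])
  have I_le: "?I \<le> (\<integral>\<^sup>+t\<in>{0..?u}. ennreal (\<phi> (of_int k * t)) \<partial>?m)" if k: "\<bar>k\<bar> \<ge> int n" for k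
  proof -
    \<comment> \<open>The infimum runs over positive frequencies only.\<close>
    define m where "m = nat \<bar>k\<bar>"
    have "?I \<le> stieltjes_integral (\<lambda>t. ennreal (\<phi> (real m * t / real n))) \<mu> 0 \<tau>"
      unfolding I_inf_def using k by (intro INF_lower) (auto simp: m_def)
    also have "\<dots> = stieltjes_integral (\<lambda>t. ennreal (\<phi> (real m * t))) (\<lambda>t. \<mu> (\<tau> * t / ?u)) 0 ?u"
      using \<tau> n by (subst stieltjes_integral_rescale[OF \<mu> \<tau> u Phi_set_measurable[OF \<phi>]])
        (simp add: field_simps)
    also have "(\<lambda>t. \<phi> (real m * t)) = (\<lambda>t. \<phi> (of_int k * t))"
    proof
      fix t
      have "\<bar>real m * t\<bar> = \<bar>of_int k * t\<bar>" by (simp add: m_def abs_mult)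
      then show "\<phi> (real m * t) = \<phi> (of_int k * t)" using Phi_set_even_abs[OF \<phi>] by metis
    qed
    finally show ?thesis by (simp add: stieltjes_integral_def)
  qed
  have "(\<Sum>k\<in>F. ?I * ennreal (l k * cmod (?c k))) \<le> stieltjes_integral (modulus M \<phi> g) (\<lambda>t. \<mu> (\<tau> * t / ?u)) 0 ?u"
    if l: "l \<in> admissible_weights M" and F: "finite F" for l F
  proof -
    let ?d = "\<lambda>k. ennreal (l k * cmod (?c k))"
    have "(\<Sum>k\<in>F. ?I * ?d k)
        \<le> (\<Sum>k\<in>F. (\<integral>\<^sup>+t. ennreal (\<phi> (of_int k * t)) * indicator {0..?u} t \<partial>?m) * ?d k)"
    proof (rule sum_mono)
      fix k
      show "?I * ?d k \<le> (\<integral>\<^sup>+t. ennreal (\<phi> (of_int k * t)) * indicator {0..?u} t \<partial>?m) * ?d k"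
        using mult_right_mono[OF I_le[of k], of "?d k"] by (cases "\<bar>k\<bar> \<ge> int n") simp_all
    qed
    also have "\<dots> = (\<integral>\<^sup>+t. (\<Sum>k\<in>F. ennreal (\<phi> (of_int k * t)) * indicator {0..?u} t * ?d k) \<partial>?m)"
      using meas by (simp add: nn_integral_sum nn_integral_multc)
    also have "\<dots> \<le> (\<integral>\<^sup>+t. modulus M \<phi> g t * indicator {0..?u} t \<partial>?m)"
    proof (rule nn_integral_mono)
      fix t
      show "(\<Sum>k\<in>F. ennreal (\<phi> (of_int k * t)) * indicator {0..?u} t * ?d k)
          \<le> modulus M \<phi> g t * indicator {0..?u} t"
      proof (cases "t \<in> {0..?u}")
        case True
        let ?g = "\<lambda>k. of_real (\<phi> (of_int k * t)) * fourier_coeff g k"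
        have "(\<Sum>k\<in>F. ennreal (\<phi> (of_int k * t)) * ?d k) \<le> (\<Sum>k\<in>F. ennreal (l k * cmod (?g k)))"
          using Phi_set_nonneg[OF \<phi>] admissible_weights_pos[OF l]
          by (intro sum_mono) (simp add: norm_mult less_imp_le mult_ac flip: ennreal_mult')
        also have "\<dots> \<le> orlicz_norm M ?g"
          by (rule sum_le_orlicz_norm[OF l F])
        also have "\<dots> \<le> modulus M \<phi> g t"
          unfolding modulus_def using True by (intro SUP_upper) auto
        finally show ?thesis using True by simp
      qed simp
    qed
    finally show ?thesis by (simp add: stieltjes_integral_def)
  qed
  then show ?thesis
    unfolding orlicz_norm_def mult.commute[of _ ?I] SUP_mult_left_ennreal infsum_cmult_ennreal[symmetric]
    by (intro SUP_least) (simp add: infsum_ennreal_le_iff)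
qed

text \<open>The conventions at the ends agree with the inequality: \<open>c / 0\<close> is infinite for \<open>c > 0\<close>, and
  \<open>I = \<infinity>\<close> forces \<open>x = 0\<close>.\<close>

lemma ennreal_le_divide_of_mult_le:
  fixes x I :: ennreal
  assumes "x * I \<le> ennreal c" "c > 0"
  shows "x \<le> ennreal c / I"
proof (cases "I = 0")
  case True
  then show ?thesis using assms by (simp add: ennreal_divide_zero)
next
  case False
  show ?thesis
  proof (cases "I = top")
    case True
    then have "x = 0"
      using assms by (metis ennreal_less_top ennreal_mult_top leD mult.commute)
    then show ?thesis by simp
  next
    case I: False
    have "x = x * I / I"
      using False I by (simp add: ennreal_mult_divide_eq)
    also have "\<dots> \<le> ennreal c / I"
      by (rule divide_right_mono_ennreal[OF assms(1)])
    finally show ?thesis .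
  qed
qed

text \<open>Outside \<open>S\<close> the factor \<open>\<psi>\<close> is at most \<open>\<bar>\<psi> n\<bar>\<close>, which leaves the tail of the
  \<open>\<psi>\<close>-derivative; the Jackson type inequality and the bound 1 on the averaged modulus control it.\<close>

lemma psi_class_residual:
  assumes \<psi>: "\<psi> \<in> Psi_set" and \<phi>: "\<phi> \<in> Phi_set" and \<mu>: "\<mu> \<in> weight_functions \<tau>"
    and \<tau>: "\<tau> > 0" and n: "n \<ge> 1"
    and S: "finite S" "{- int n<..<int n} \<subseteq> S" and f: "f \<in> psi_class M \<psi> \<phi> \<tau> \<mu> n"
  shows "fnorm M (f - partial_sum S f) \<le> ennreal (\<mu> \<tau> - \<mu> 0) / I_inf n \<phi> \<tau> \<mu> * ennreal (cmod (\<psi> n))"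
proof -
  obtain g where g: "is_psi_integral \<psi> g f" "averaged_modulus M \<phi> g \<tau> \<mu> (\<tau> / real n) \<le> 1"
    using f by (auto simp: psi_class_def)
  let ?c = "\<lambda>k. if \<bar>k\<bar> \<ge> int n then fourier_coeff g k else 0"
  let ?s = "stieltjes_integral (modulus M \<phi> g) (\<lambda>t. \<mu> (\<tau> * t / (\<tau> / real n))) 0 (\<tau> / real n)"
  have pos: "\<mu> \<tau> - \<mu> 0 > 0" by (rule weight_function_increment_pos[OF \<mu> \<tau>])
  have mono: "mono_on {0..\<tau>} \<mu>" using \<mu> by (simp add: weight_functions_def)
  have "orlicz_norm M ?c * I_inf n \<phi> \<tau> \<mu> \<le> ?s"
    by (rule jackson_inequality[OF \<phi> mono \<tau> n])
  also have "\<dots> = ?s / ennreal (\<mu> \<tau> - \<mu> 0) * ennreal (\<mu> \<tau> - \<mu> 0)"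
    using pos by (simp add: ennreal_divide_times ennreal_mult_divide_eq)
  also have "\<dots> \<le> 1 * ennreal (\<mu> \<tau> - \<mu> 0)"
    using g(2) by (intro mult_right_mono) (simp_all add: averaged_modulus_def)
  finally have tail: "orlicz_norm M ?c \<le> ennreal (\<mu> \<tau> - \<mu> 0) / I_inf n \<phi> \<tau> \<mu>"
    using pos by (intro ennreal_le_divide_of_mult_le) simp_all
  have "fnorm M (f - partial_sum S f) \<le> ennreal (cmod (\<psi> n)) * orlicz_norm M ?c"
    unfolding fnorm_def
  proof (rule orlicz_norm_le_scaled)
    fix k
    show "cmod (fourier_coeff (f - partial_sum S f) k) \<le> cmod (\<psi> n) * cmod (?c k)"
    proof (cases "k \<in> S")
      case True
      then show ?thesis by (simp add: fourier_coeff_diff fourier_coeff_partial_sum[OF S(1)])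
    next
      case False
      then have "k \<notin> {- int n<..<int n}" using S(2) by blast
      then have k: "\<bar>k\<bar> \<ge> int n" by auto
      then have "cmod (\<psi> k) \<le> cmod (\<psi> n)"
        using n by (intro Psi_set_antimono[OF \<psi>]) auto
      then show ?thesis
        using k False g(1)
        by (simp add: fourier_coeff_diff fourier_coeff_partial_sum[OF S(1)] is_psi_integral_def
            norm_mult mult_right_mono)
    qed
  qed simp
  also have "\<dots> \<le> ennreal (cmod (\<psi> n)) * (ennreal (\<mu> \<tau> - \<mu> 0) / I_inf n \<phi> \<tau> \<mu>)"
    by (intro mult_left_mono tail) simp
  finally show ?thesis by (simp add: mult.commute)
qed

text \<open>The \<open>\<psi>\<close>-derivative is obtained by dividing coefficients, each by a number of modulus at
  least \<open>\<bar>\<psi> n\<bar>\<close>, except possibly the one at frequency \<open>0\<close>. That one is harmless however small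
  \<open>\<psi> 0\<close> is, since \<open>\<phi> 0 = 0\<close> removes it from every modulus.\<close>

lemma ball_subset_psi_class:
  assumes M: "\<And>k. orlicz_function (M k)"
    and \<psi>: "\<psi> \<in> Psi_set" and \<phi>: "\<phi> \<in> Phi_set" "mono_on {0..\<tau>} \<phi>" and \<mu>: "\<mu> \<in> weight_functions \<tau>"
    and \<tau>: "\<tau> > 0" and n: "n \<ge> 1" and \<psi>n: "\<psi> n \<noteq> 0"
    and S: "S \<subseteq> {- int n..int n}" "0 \<in> S \<Longrightarrow> \<psi> 0 \<noteq> 0"
    and r: "r \<ge> 0" "ennreal r * stieltjes_integral (\<lambda>t. ennreal (\<phi> t)) \<mu> 0 \<tau>
      \<le> ennreal (\<mu> \<tau> - \<mu> 0) * ennreal (cmod (\<psi> n))"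
    and f: "f \<in> trig_space S" "fnorm M f \<le> ennreal r"
  shows "f \<in> psi_class M \<psi> \<phi> \<tau> \<mu> n"
proof -
  let ?u = "\<tau> / real n" and ?q = "cmod (\<psi> n)"
  let ?J = "stieltjes_integral (\<lambda>t. ennreal (\<phi> t)) \<mu> 0 \<tau>"
  have fin: "finite S" using S(1) finite_subset by blast
  have u: "?u > 0" using \<tau> n by simp
  have q: "?q > 0" using \<psi>n by simp
  have pos: "\<mu> \<tau> - \<mu> 0 > 0" by (rule weight_function_increment_pos[OF \<mu> \<tau>])
  have mono: "mono_on {0..\<tau>} \<mu>" using \<mu> by (simp add: weight_functions_def)
  have \<phi>0: "\<phi> 0 = 0" using \<phi>(1) by (simp add: Phi_set_def)
  have large: "?q \<le> cmod (\<psi> k)" if "k \<in> S" "k \<noteq> 0" for k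
  proof (rule Psi_set_antimono[OF \<psi>])
    show "1 \<le> \<bar>k\<bar>" using that by simp
    have "k \<in> {- int n..int n}" using that S(1) by blast
    then show "\<bar>k\<bar> \<le> \<bar>int n\<bar>" by auto
  qed
  have nz: "\<psi> k \<noteq> 0" if "k \<in> S" for k
    using large[OF that] S(2) that q by (cases "k = 0") auto
  define g where "g = trig_poly S (\<lambda>k. fourier_coeff f k / \<psi> k)"
  have coeff_g: "fourier_coeff g k = (if k \<in> S then fourier_coeff f k / \<psi> k else 0)" for k
    by (simp add: g_def fourier_coeff_trig_poly[OF fin])
  have "g \<in> trig_space S"
    using fin coeff_g by (simp add: trig_space_iff)
  then have g_space: "g \<in> orlicz_space M"
    using trig_space_subset_orlicz_space[of M, OF M fin] by blast
  have g_psi: "is_psi_integral \<psi> g f"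
    using nz fourier_coeff_trig_space[OF f(1)] by (simp add: is_psi_integral_def coeff_g)
  have mod_le: "modulus M \<phi> g t \<le> ennreal (\<phi> (real n * t)) * ennreal (r / ?q)" if t: "t \<in> {0..?u}" for t
    unfolding modulus_def
  proof (rule SUP_least)
    fix h assume h: "h \<in> {h. \<bar>h\<bar> \<le> t}"
    have "orlicz_norm M (\<lambda>k. of_real (\<phi> (of_int k * h)) * fourier_coeff g k)
        \<le> ennreal (\<phi> (real n * t) / ?q) * orlicz_norm M (fourier_coeff f)"
    proof (rule orlicz_norm_le_scaled)
      fix k
      show "cmod (of_real (\<phi> (of_int k * h)) * fourier_coeff g k)
          \<le> \<phi> (real n * t) / ?q * cmod (fourier_coeff f k)"
      proof (cases "k \<in> S \<and> k \<noteq> 0")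
        case True
        then have "k \<in> {- int n..int n}" using S(1) by blast
        then have "\<bar>k\<bar> \<le> int n" by auto
        then have kh: "\<bar>of_int k * h\<bar> \<le> real n * t"
          unfolding abs_mult using h by (intro mult_mono; (linarith | simp))
        moreover have "real n * t \<le> \<tau>"
          using t n by (simp add: field_simps)
        ultimately have "\<phi> \<bar>of_int k * h\<bar> \<le> \<phi> (real n * t)"
          using \<phi>(2) by (intro mono_onD[of "{0..\<tau>}" \<phi>]) auto
        then have "\<phi> (of_int k * h) \<le> \<phi> (real n * t)"
          by (simp add: Phi_set_even_abs[OF \<phi>(1)])
        moreover have "cmod (fourier_coeff f k) / cmod (\<psi> k) \<le> cmod (fourier_coeff f k) / ?q"
          using True large[of k] nz[of k] q by (intro divide_left_mono mult_pos_pos) auto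
        ultimately have "\<phi> (of_int k * h) * (cmod (fourier_coeff f k) / cmod (\<psi> k))
            \<le> \<phi> (real n * t) * (cmod (fourier_coeff f k) / ?q)"
          using Phi_set_nonneg[OF \<phi>(1)] by (intro mult_mono) auto
        then show ?thesis
          using True Phi_set_nonneg[OF \<phi>(1)] by (simp add: coeff_g norm_mult norm_divide)
      next
        case False
        then have zero: "cmod (of_real (\<phi> (of_int k * h)) * fourier_coeff g k) = 0"
          by (auto simp: \<phi>0 coeff_g)
        show ?thesis
          unfolding zero using Phi_set_nonneg[OF \<phi>(1)] by simp
      qed
    qed (use Phi_set_nonneg[OF \<phi>(1)] in simp)
    also have "\<dots> \<le> ennreal (\<phi> (real n * t) / ?q) * ennreal r"
      using f(2) by (intro mult_left_mono) (simp_all add: fnorm_def)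
    also have "\<dots> = ennreal (\<phi> (real n * t)) * ennreal (r / ?q)"
      using Phi_set_nonneg[OF \<phi>(1)] r by (simp flip: ennreal_mult)
    finally show "orlicz_norm M (\<lambda>k. of_real (\<phi> (of_int k * h)) * fourier_coeff g k)
        \<le> ennreal (\<phi> (real n * t)) * ennreal (r / ?q)" .
  qed
  let ?m = "stieltjes_measure (\<lambda>t. \<mu> (\<tau> * t / ?u)) 0 ?u"
  have meas: "(\<lambda>t. ennreal (\<phi> (real n * t)) * indicator {0..?u} t) \<in> borel_measurable ?m"
    by (rule Phi_set_measurable_indicator[OF \<phi>(1)])
  have "stieltjes_integral (modulus M \<phi> g) (\<lambda>t. \<mu> (\<tau> * t / ?u)) 0 ?u
      \<le> (\<integral>\<^sup>+t. ennreal (\<phi> (real n * t)) * indicator {0..?u} t * ennreal (r / ?q) \<partial>?m)"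
    unfolding stieltjes_integral_def
  proof (rule nn_integral_mono)
    fix t
    show "modulus M \<phi> g t * indicator {0..?u} t
        \<le> ennreal (\<phi> (real n * t)) * indicator {0..?u} t * ennreal (r / ?q)"
      using mod_le[of t] by (cases "t \<in> {0..?u}") simp_all
  qed
  also have "\<dots> = stieltjes_integral (\<lambda>t. ennreal (\<phi> (real n * t))) (\<lambda>t. \<mu> (\<tau> * t / ?u)) 0 ?u * ennreal (r / ?q)"
    using meas by (simp add: nn_integral_multc stieltjes_integral_def)
  also have "\<dots> = ?J * ennreal (r / ?q)"
    using \<tau> n by (subst stieltjes_integral_rescale[OF mono \<tau> u Phi_set_measurable[OF \<phi>(1)]]) simp
  also have "\<dots> = ennreal r * ?J * ennreal (1 / ?q)"
  proof -
    have "ennreal (r / ?q) = ennreal r * ennreal (1 / ?q)"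
      using r by (simp flip: ennreal_mult)
    then show ?thesis by (simp only: mult_ac)
  qed
  also have "\<dots> \<le> ennreal (\<mu> \<tau> - \<mu> 0) * ennreal ?q * ennreal (1 / ?q)"
    using r(2) by (intro mult_right_mono) auto
  also have "\<dots> = ennreal (\<mu> \<tau> - \<mu> 0)"
    using q pos by (simp flip: ennreal_mult')
  finally have "averaged_modulus M \<phi> g \<tau> \<mu> ?u \<le> ennreal (\<mu> \<tau> - \<mu> 0) / ennreal (\<mu> \<tau> - \<mu> 0)"
    unfolding averaged_modulus_def by (rule divide_right_mono_ennreal)
  also have "\<dots> = 1"
    using pos by (simp add: ennreal_divide_self)
  finally show ?thesis
    using g_space g_psi by (auto simp: psi_class_def)
qed

lemma ennreal_mult_le_of_less_divide:
  fixes J :: ennreal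
  assumes "ennreal s < ennreal c / J * ennreal q" 
  shows "ennreal s * J \<le> ennreal c * ennreal q"
proof (cases "J = 0")
  case False
  have "J \<noteq> top"
    using assms by auto
  have "ennreal s * J \<le> ennreal c / J * ennreal q * J"
    using assms by (intro mult_right_mono) auto
  also have "\<dots> = ennreal c / J * J * ennreal q"
    by (simp add: mult_ac)
  also have "ennreal c / J * J = ennreal c"
    using False \<open>J \<noteq> top\<close> by (simp add: ennreal_divide_times ennreal_divide_self top.not_eq_extremum)
  finally show ?thesis .
qed simp

theorem theorem3p2:
  fixes M :: "int \<Rightarrow> real \<Rightarrow> real" and \<psi> :: "int \<Rightarrow> complex" and \<phi> \<mu> :: "real \<Rightarrow> real"
    and \<tau> :: real and n N :: nat and P :: "nat \<Rightarrow> lper set \<Rightarrow> ennreal"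
  assumes "\<And>k. orlicz_function (M k)"
    and "\<And>k. orlicz_conjugate (M k) 1 = 1"
    and "\<And>k v. v > 1 \<Longrightarrow> orlicz_conjugate (M k) v > orlicz_conjugate (M k) 1"
    and "\<psi> \<in> Psi_set"
    and "\<tau> > 0"
    and "\<phi> \<in> Phi_set" and "mono_on {0..\<tau>} \<phi>"
    and "\<mu> \<in> weight_functions \<tau>"
    and "n \<ge> 1" and "N \<in> {2 * n - 1, 2 * n}"
    and "P \<in> {bernstein_width M, kolmogorov_width M, linear_width M, projection_width M}"
  shows "let K = psi_class M \<psi> \<phi> \<tau> \<mu> n;
             J = stieltjes_integral (\<lambda>t. ennreal (\<phi> t)) \<mu> 0 \<tau>;
             I = I_inf n \<phi> \<tau> \<mu>
         in P N K \<le> ennreal (\<mu> \<tau> - \<mu> 0) / I * ennreal (cmod (\<psi> n)) \<and>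
            (\<psi> 0 \<noteq> 0 \<or> N = 2 * n - 1 \<longrightarrow>
               ennreal (\<mu> \<tau> - \<mu> 0) / J * ennreal (cmod (\<psi> n)) \<le> P N K \<and>
               (I = J \<longrightarrow> P N K = ennreal (\<mu> \<tau> - \<mu> 0) / J * ennreal (cmod (\<psi> n))))"
proof -
  define K where "K = psi_class M \<psi> \<phi> \<tau> \<mu> n"
  define J where "J = stieltjes_integral (\<lambda>t. ennreal (\<phi> t)) \<mu> 0 \<tau>"
  define I where "I = I_inf n \<phi> \<tau> \<mu>"
  let ?c = "\<mu> \<tau> - \<mu> 0" and ?q = "cmod (\<psi> n)"
  note M = assms(1)
  obtain l where l: "l \<in> admissible_weights M"
    using ex_admissible_weights[of M] assms(1,2) by auto
  have upper: "P N K \<le> ennreal ?c / I * ennreal ?q"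
  proof -
    \<comment> \<open>One extra frequency makes \<open>2 n\<close> of the \<open>2 n - 1\<close> frequencies below \<open>n\<close> in modulus.\<close>
    define S where "S = (if N = 2 * n then {- int n<..int n} else {- int n<..<int n})"
    have S: "finite S" "{- int n<..<int n} \<subseteq> S" "card S = N"
      using assms(9,10) by (auto simp: S_def)
    have "P (card S) K \<le> ennreal ?c / I * ennreal ?q"
      using psi_class_residual[OF assms(4,6,8,5,9) S(1,2)]
      by (intro widths_le[of M, OF M l S(1) _ assms(11)]) (simp add: K_def I_def)
    then show ?thesis using S by simp
  qed
  have lower: "ennreal ?c / J * ennreal ?q \<le> P N K" if case_N: "\<psi> 0 \<noteq> 0 \<or> N = 2 * n - 1"
  proof (rule dense_le)
    fix x assume x: "x < ennreal ?c / J * ennreal ?q"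
    \<comment> \<open>The lower bound needs \<open>N + 1\<close> frequencies of modulus at most \<open>n\<close>; frequency \<open>0\<close> is used
      only if \<open>\<psi> 0 \<noteq> 0\<close> is available.\<close>
    define S where "S = (if N = 2 * n then {- int n..int n} else {- int n..int n} - {0})"
    have S: "finite S" "card S = N + 1" "S \<subseteq> {- int n..int n}" "0 \<in> S \<Longrightarrow> \<psi> 0 \<noteq> 0"
      using assms(9,10) case_N by (auto simp: S_def split: if_splits)
    have \<psi>n: "\<psi> n \<noteq> 0" using x by auto
    obtain s where s: "x = ennreal s" "s \<ge> 0"
      using x by (cases x) auto
    show "x \<le> P N K"
    proof (cases "s = 0")
      case False
      have r: "ennreal s * J \<le> ennreal ?c * ennreal ?q"
        using ennreal_mult_le_of_less_divide x s by blast
      have "ennreal s \<le> P N K"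
        using ball_subset_psi_class[of M, OF M assms(4,6,7,8,5,9) \<psi>n S(3,4) s(2) r[unfolded J_def]]
          s False
        by (intro widths_ge[of M, OF M l S(1,2) _ _ assms(11)]) (auto simp: K_def)
      then show ?thesis using s by simp
    qed (use s in simp)
  qed
  show ?thesis
    using upper lower unfolding Let_def K_def[symmetric] J_def[symmetric] I_def[symmetric] by auto
qed

end
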